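(* Let $n\ge 4$ and let $g:\mathbb{S}^{n-1}\to\mathbb{R}$ be a smooth enough function (in particular continuous), so that the cosine transform of the measure $g\,d\mathcal{H}^{n-1}(\cdot)$ is of class $C^2$. Assume, furthermore, that there exist $k\ge 3$, a subspace $H\in G_{n,k}$ and an open subset $U$ of $\mathbb{S}^{n-1}\cap H$ such that $g|_{\mathbb{S}^{n-1}\cap u^\perp}$ is isotropic for all $u\in U$. Then $(\mathcal{R}g)|_U$ is constant.
   Context: $\mathbb{S}^{n-1}$ is the Euclidean unit sphere of $\mathbb{R}^n$, $u^\perp$ is the hyperplane through the origin orthogonal to $u$, and $\mathcal{H}^{a}$ is $a$-dimensional Hausdorff measure. For $k=1,\dots,n-1$, $G_{n,k}$ is the set of $k$-dimensional linear subspaces of $\mathbb{R}^n$. The cosine transform of $g\,d\mathcal{H}^{n-1}$ is $\mathcal{C}(g)(u)=\int_{\mathbb{S}^{n-1}}|\langle x,u\rangle|\,g(x)\,d\mathcal{H}^{n-1}(x)$ and the Funk transform of $g$ is $\mathcal{R}(g)(u)=\int_{\mathbb{S}^{n-1}\cap u^\perp}g(x)\,d\mathcal{H}^{n-2}(x)$, $u\in\mathbb{S}^{n-1}$. The restriction $g|_{\mathbb{S}^{n-1}\cap u^\perp}$ is called isotropic if the map $\mathbb{S}^{n-1}\cap u^\perp\ni v\mapsto\int_{\mathbb{S}^{n-1}\cap u^\perp}\langle x,v\rangle^2 g(x)\,d\mathcal{H}^{n-2}(x)$ is constant.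
   Formalization: The conclusion is that Rg is constant on each connected component of U (on U itself if U is connected); for disconnected U the claim as stated fails, e.g. when C(g) equals |x| near one antipodal pair and 2|x| near another. *)

theory Defs
  imports "HOL-Analysis.Analysis"
begin

section \<open>Hausdorff measure\<close>

text \<open>
  The weight of a covering set is normalised so that in Euclidean space of dimension \<open>a\<close> the
  measure agrees with Lebesgue measure. The empty set is treated separately only because
  \<open>0 ^ 0 = 1\<close>. Boundedness is required of covering sets because \<open>diameter\<close> is
  meaningless for unbounded ones.
\<close>

definition hausdorff_weight :: "nat \<Rightarrow> 'a::metric_space set \<Rightarrow> ennreal" where
  "hausdorff_weight a C =
     (if C = {} then 0 else ennreal (unit_ball_vol (real a) * (diameter C / 2) ^ a))"

definition hausdorff_content :: "nat \<Rightarrow> real \<Rightarrow> 'a::metric_space set \<Rightarrow> ennreal" where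
  "hausdorff_content a \<delta> A =
     (INF C\<in>{C :: nat \<Rightarrow> 'a set.
              A \<subseteq> (\<Union>i. C i) \<and> (\<forall>i. bounded (C i) \<and> diameter (C i) \<le> \<delta>)}.
        \<Sum>i. hausdorff_weight a (C i))"

definition hausdorff_outer :: "nat \<Rightarrow> 'a::metric_space set \<Rightarrow> ennreal" where
  "hausdorff_outer a A = (SUP \<delta>\<in>{0<..}. hausdorff_content a \<delta> A)"

text \<open>
  \<open>measure_of\<close> yields the zero measure when it is given a function that is not countably
  additive. The lemma \<open>emeasure_hausdorff_measure\<close> below shows that this does not happen.
\<close>

definition hausdorff_measure :: "nat \<Rightarrow> 'a::metric_space measure" where
  "hausdorff_measure a = measure_of UNIV (sets borel) (hausdorff_outer a)"

lemma hausdorff_weight_empty [simp]: "hausdorff_weight a {} = 0"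
  by (simp add: hausdorff_weight_def)

lemma hausdorff_content_le:
  assumes "A \<subseteq> (\<Union>i. C i)" "\<And>i. bounded (C i)" "\<And>i. diameter (C i) \<le> \<delta>"
  shows "hausdorff_content a \<delta> A \<le> (\<Sum>i. hausdorff_weight a (C i))"
  unfolding hausdorff_content_def using assms by (intro INF_lower) auto

lemma hausdorff_content_close:
  assumes "hausdorff_content a \<delta> A < e"
  obtains C where "A \<subseteq> (\<Union>i. C i)" "\<And>i. bounded (C i)" "\<And>i. diameter (C i) \<le> \<delta>"
    "(\<Sum>i. hausdorff_weight a (C i)) < e"
  using assms unfolding hausdorff_content_def INF_less_iff by auto

lemma hausdorff_content_empty: "0 < \<delta> \<Longrightarrow> hausdorff_content a \<delta> {} = 0"
  using hausdorff_content_le[of "{}" "\<lambda>_. {}" \<delta> a] by simp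

lemma hausdorff_content_mono: "A \<subseteq> B \<Longrightarrow> hausdorff_content a \<delta> A \<le> hausdorff_content a \<delta> B"
  unfolding hausdorff_content_def by (rule INF_superset_mono) auto

lemma hausdorff_content_antimono:
  "d \<le> \<delta> \<Longrightarrow> hausdorff_content a \<delta> A \<le> hausdorff_content a d A"
  unfolding hausdorff_content_def by (rule INF_superset_mono) (auto intro: order_trans)

lemma hausdorff_content_subadditive:
  fixes A :: "nat \<Rightarrow> 'a::metric_space set"
  shows "hausdorff_content a \<delta> (\<Union>i. A i) \<le> (\<Sum>i. hausdorff_content a \<delta> (A i))"
proof (rule ennreal_le_epsilon)
  fix e :: real
  assume "0 < e" and fin: "(\<Sum>i. hausdorff_content a \<delta> (A i)) < top"
  have "hausdorff_content a \<delta> (A n) < hausdorff_content a \<delta> (A n) + e * (1/2)^Suc n" for n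
    using fin \<open>0 < e\<close> by (auto simp: less_top dest!: ennreal_suminf_lessD)
  then have "\<exists>C. A n \<subseteq> (\<Union>i. C i) \<and> (\<forall>i. bounded (C i) \<and> diameter (C i) \<le> \<delta>) \<and>
      (\<Sum>i. hausdorff_weight a (C i)) < hausdorff_content a \<delta> (A n) + e * (1/2)^Suc n" for n
    by (rule hausdorff_content_close[of a \<delta> "A n"]) blast
  then obtain B where B: "\<And>n. A n \<subseteq> (\<Union>i. B n i)"
      "\<And>n i. bounded (B n i)" "\<And>n i. diameter (B n i) \<le> \<delta>"
      "\<And>n. (\<Sum>i. hausdorff_weight a (B n i)) < hausdorff_content a \<delta> (A n) + e * (1/2)^Suc n"
    by metis
  define C where "C = case_prod B \<circ> prod_decode"
  have "(\<Union>i. A i) \<subseteq> (\<Union>i. C i)"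
    using B(1) by (auto simp: C_def subset_eq) (metis prod.case prod_encode_inverse)
  then have "hausdorff_content a \<delta> (\<Union>i. A i) \<le> (\<Sum>i. hausdorff_weight a (C i))"
    by (rule hausdorff_content_le) (auto simp: C_def split_def B)
  also have "\<dots> = (\<Sum>n. \<Sum>i. hausdorff_weight a (B n i))"
    using suminf_ennreal_2dimen[of "\<lambda>n. \<Sum>i. hausdorff_weight a (B n i)"
        "\<lambda>(n, i). hausdorff_weight a (B n i)"]
    by (simp add: C_def comp_def split_def)
  also have "\<dots> \<le> (\<Sum>n. hausdorff_content a \<delta> (A n) + e * (1/2) ^ Suc n)"
    using B(4) by (intro suminf_le) (auto intro: less_imp_le)
  also have "\<dots> = (\<Sum>n. hausdorff_content a \<delta> (A n)) + (\<Sum>n. ennreal e * ennreal ((1/2) ^ Suc n))"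
    using \<open>0 < e\<close> by (subst suminf_add[symmetric])
      (auto simp del: ennreal_suminf_cmult simp add: ennreal_mult[symmetric])
  also have "\<dots> = (\<Sum>n. hausdorff_content a \<delta> (A n)) + e"
    unfolding ennreal_suminf_cmult
    by (subst suminf_ennreal_eq[OF zero_le_power power_half_series]) auto
  finally show "hausdorff_content a \<delta> (\<Union>i. A i) \<le> (\<Sum>i. hausdorff_content a \<delta> (A i)) + e" .
qed

lemma hausdorff_outer_empty: "hausdorff_outer a {} = 0"
  by (simp add: hausdorff_outer_def hausdorff_content_empty)

lemma hausdorff_outer_mono: "A \<subseteq> B \<Longrightarrow> hausdorff_outer a A \<le> hausdorff_outer a B"
  unfolding hausdorff_outer_def by (intro SUP_mono') (rule hausdorff_content_mono)

lemma hausdorff_content_le_outer: "0 < \<delta> \<Longrightarrow> hausdorff_content a \<delta> A \<le> hausdorff_outer a A"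
  unfolding hausdorff_outer_def by (rule SUP_upper) simp

lemma hausdorff_outer_subadditive:
  "hausdorff_outer a (\<Union>i::nat. A i) \<le> (\<Sum>i. hausdorff_outer a (A i))"
proof -
  have "hausdorff_content a \<delta> (\<Union>i. A i) \<le> (\<Sum>i. hausdorff_outer a (A i))" if "0 < \<delta>" for \<delta>
    by (rule order_trans[OF hausdorff_content_subadditive])
       (auto intro!: suminf_le hausdorff_content_le_outer that)
  then show ?thesis
    by (subst hausdorff_outer_def) (auto intro!: SUP_least)
qed

lemma hausdorff_outer_Un: "hausdorff_outer a (A \<union> B) \<le> hausdorff_outer a A + hausdorff_outer a B"
proof -
  have "countably_subadditive UNIV (hausdorff_outer a)" "positive UNIV (hausdorff_outer a)"
    by (auto simp: countably_subadditive_def positive_def hausdorff_outer_empty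
        intro: hausdorff_outer_subadditive)
  then have sub: "subadditive UNIV (hausdorff_outer a)"
    using ring_of_sets.countably_subadditive_subadditive[OF ring_of_sets_Pow[of UNIV]] by simp
  have "hausdorff_outer a (A \<union> (B - A)) \<le> hausdorff_outer a A + hausdorff_outer a (B - A)"
    using sub by (intro subadditiveD) auto
  also have "\<dots> \<le> hausdorff_outer a A + hausdorff_outer a B"
    by (intro add_left_mono hausdorff_outer_mono) auto
  finally show ?thesis by simp
qed

lemma hausdorff_outer_separated:
  fixes A B :: "'a::metric_space set"
  assumes s: "0 < s" and sep: "\<And>x y. x \<in> A \<Longrightarrow> y \<in> B \<Longrightarrow> s \<le> dist x y"
  shows "hausdorff_outer a A + hausdorff_outer a B \<le> hausdorff_outer a (A \<union> B)"
proof -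
  have *: "hausdorff_content a \<delta> A + hausdorff_content a \<delta>' B \<le> hausdorff_outer a (A \<union> B)"
    if d: "0 < \<delta>" "0 < \<delta>'" for \<delta> \<delta>'
  proof -
    define d where "d = Min {\<delta>, \<delta>', s/2}"
    have d0: "0 < d" "d \<le> \<delta>" "d \<le> \<delta>'" "d \<le> s/2" using d s by (auto simp: d_def)
    have "hausdorff_content a \<delta> A + hausdorff_content a \<delta>' B \<le>
        hausdorff_content a d A + hausdorff_content a d B"
      using d0 by (intro add_mono hausdorff_content_antimono)
    also have "\<dots> \<le> hausdorff_content a d (A \<union> B)"
      unfolding hausdorff_content_def[of a d "A \<union> B"]
    proof (rule INF_greatest, safe)
      fix C :: "nat \<Rightarrow> 'a set"
      assume cov: "A \<union> B \<subseteq> (\<Union>i. C i)" and C: "\<forall>i. bounded (C i) \<and> diameter (C i) \<le> d"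
      define P where "P = (\<lambda>S i. if C i \<inter> S = {} then {} else C i)"
      have P: "hausdorff_content a d S \<le> (\<Sum>i. hausdorff_weight a (P S i))" if "S \<subseteq> A \<union> B" for S
      proof (rule hausdorff_content_le)
        show "S \<subseteq> (\<Union>i. P S i)"
          using that cov by (fastforce simp: P_def)
        show "bounded (P S i)" "diameter (P S i) \<le> d" for i
          using C d0 by (auto simp: P_def)
      qed
      have "hausdorff_content a d A + hausdorff_content a d B
          \<le> (\<Sum>i. hausdorff_weight a (P A i)) + (\<Sum>i. hausdorff_weight a (P B i))"
        by (intro add_mono P) auto
      also have "\<dots> = (\<Sum>i. hausdorff_weight a (P A i) + hausdorff_weight a (P B i))"
        by (rule suminf_add) auto
      also have "\<dots> \<le> (\<Sum>i. hausdorff_weight a (C i))"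
      proof (rule suminf_le)
        fix i
        have "C i \<inter> A = {} \<or> C i \<inter> B = {}"
        proof (rule ccontr)
          assume "\<not> ?thesis"
          then obtain x y where xy: "x \<in> C i" "x \<in> A" "y \<in> C i" "y \<in> B" by auto
          then have "dist x y \<le> d" using C diameter_bounded_bound order_trans by metis
          then show False using sep[OF xy(2,4)] d0 s by linarith
        qed
        then show "hausdorff_weight a (P A i) + hausdorff_weight a (P B i) \<le> hausdorff_weight a (C i)"
          by (auto simp: P_def)
      qed auto
      finally show "hausdorff_content a d A + hausdorff_content a d B
          \<le> (\<Sum>i. hausdorff_weight a (C i))" .
    qed
    also have "\<dots> \<le> hausdorff_outer a (A \<union> B)"
      using d0 by (intro hausdorff_content_le_outer)
    finally show ?thesis .
  qed
  have "hausdorff_outer a A + hausdorff_content a \<delta>' B \<le> hausdorff_outer a (A \<union> B)"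
    if "0 < \<delta>'" for \<delta>'
    unfolding hausdorff_outer_def[of a A]
    by (subst ennreal_SUP_add_left[symmetric]) (auto intro!: SUP_least * that)
  then show ?thesis
    unfolding hausdorff_outer_def[of a B]
    unfolding add.commute[of "hausdorff_outer a A"]
    by (subst ennreal_SUP_add_left[symmetric]) (auto intro!: SUP_least simp: add.commute)
qed

lemma closed_hausdorff_outer_measurable:
  fixes F X :: "'a::metric_space set"
  assumes F: "closed F"
  shows "hausdorff_outer a (X \<inter> F) + hausdorff_outer a (X - F) \<le> hausdorff_outer a X"
proof (cases "F = {} \<or> hausdorff_outer a X = top")
  case True
  then show ?thesis by (auto simp: hausdorff_outer_empty)
next
  case False
  then have ne: "F \<noteq> {}" and fin: "hausdorff_outer a X \<noteq> top" by auto
  let ?\<mu> = "hausdorff_outer a"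
  define h where "h = (\<lambda>x. infdist x F)"
  have h_le: "h x - h y \<le> dist x y" for x y
    using infdist_triangle[of x F y] by (simp add: h_def)
  define r where "r = (\<lambda>k::nat. 1 / real (Suc k))"
  have r_pos: "0 < r k" for k by (simp add: r_def)
  have r_less: "r (Suc k) < r k" for k by (simp add: r_def field_simps)
  have r_mono: "j \<le> k \<Longrightarrow> r k \<le> r j" for j k by (simp add: r_def field_simps)
  define A where "A = (\<lambda>k. {x \<in> X. r k \<le> h x})"
  define D where "D = (\<lambda>k. {x \<in> X. r (Suc k) \<le> h x \<and> h x < r k})"
  have part: "(\<Sum>i<N. ?\<mu> (D (2 * i + p))) \<le> ?\<mu> (\<Union>i<N. D (2 * i + p))" for N p
  proof (induction N)
    case 0
    show ?case by simp
  next
    case (Suc N)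
    have "(\<Sum>i<Suc N. ?\<mu> (D (2 * i + p)))
        \<le> ?\<mu> (\<Union>i<N. D (2 * i + p)) + ?\<mu> (D (2 * N + p))"
      using Suc by (simp add: add_right_mono)
    also have "\<dots> \<le> ?\<mu> ((\<Union>i<N. D (2 * i + p)) \<union> D (2 * N + p))"
    proof (cases "N = 0")
      case True
      then show ?thesis by (simp add: hausdorff_outer_empty)
    next
      case N: False
      let ?m = "2 * N + p - 1"
      have m: "Suc ?m = 2 * N + p" using N by simp
      show ?thesis
      proof (rule hausdorff_outer_separated[of "r ?m - r (Suc ?m)"])
        show "0 < r ?m - r (Suc ?m)" using r_less[of ?m] by simp
        fix x y assume x: "x \<in> (\<Union>i<N. D (2 * i + p))" and y: "y \<in> D (2 * N + p)"
        from x obtain i where i: "i < N" "x \<in> D (2 * i + p)" by auto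
        have "r ?m \<le> r (Suc (2 * i + p))" using i by (intro r_mono) auto
        also have "\<dots> \<le> h x" using i by (simp add: D_def)
        finally have "r ?m \<le> h x" .
        moreover have "h y < r (Suc ?m)" using y unfolding D_def m by simp
        ultimately show "r ?m - r (Suc ?m) \<le> dist x y" using h_le[of x y] by linarith
      qed
    qed
    also have "\<dots> = ?\<mu> (\<Union>i<Suc N. D (2 * i + p))"
      by (simp add: lessThan_Suc Un_commute)
    finally show ?case .
  qed
  have half: "(\<Sum>i. ?\<mu> (D (2 * i + p))) \<le> ?\<mu> X" for p
  proof (rule suminf_le_const)
    show "(\<Sum>i<N. ?\<mu> (D (2 * i + p))) \<le> ?\<mu> X" for N
      by (rule order_trans[OF part]) (auto intro!: hausdorff_outer_mono simp: D_def)
  qed auto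
  have D_fin: "?\<mu> (D k) \<noteq> top" for k
    using hausdorff_outer_mono[of "D k" X a] fin by (auto simp: D_def top_unique)
  have sums: "(\<Sum>k. ?\<mu> (D k)) \<noteq> top"
  proof -
    have "(\<Sum>k<N. ?\<mu> (D k)) \<le> ?\<mu> X + ?\<mu> X" for N
    proof -
      have "(\<Sum>k<N. ?\<mu> (D k)) \<le> (\<Sum>k<2 * N. ?\<mu> (D k))"
        by (rule sum_mono2) auto
      also have "\<dots> = (\<Sum>i<N. ?\<mu> (D (2 * i + 0))) + (\<Sum>i<N. ?\<mu> (D (2 * i + 1)))"
        by (induction N) (simp_all add: algebra_simps)
      also have "\<dots> \<le> (\<Sum>i. ?\<mu> (D (2 * i + 0))) + (\<Sum>i. ?\<mu> (D (2 * i + 1)))"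
        by (intro add_mono sum_le_suminf) auto
      also have "\<dots> \<le> ?\<mu> X + ?\<mu> X"
        by (intro add_mono half)
      finally show ?thesis .
    qed
    then have "(\<Sum>k. ?\<mu> (D k)) \<le> ?\<mu> X + ?\<mu> X"
      by (intro suminf_le_const) auto
    with fin show ?thesis by (auto simp: top_unique)
  qed
  have split: "?\<mu> (X - F) \<le> ?\<mu> (A n) + (\<Sum>k. ?\<mu> (D (k + n)))" for n
  proof -
    have "X - F \<subseteq> A n \<union> (\<Union>k. D (k + n))"
    proof
      fix x assume x: "x \<in> X - F"
      then have "0 < h x"
        using F ne infdist_pos_not_in_closed[of F x] by (auto simp: h_def)
      then obtain m where m: "r m < h x"
        unfolding r_def by (rule nat_approx_posE)
      define j where "j = (LEAST j. r j \<le> h x)"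
      have j: "r j \<le> h x" unfolding j_def using m LeastI[of "\<lambda>j. r j \<le> h x" m] by simp
      show "x \<in> A n \<union> (\<Union>k. D (k + n))"
      proof (cases "r n \<le> h x")
        case True
        then show ?thesis using x by (simp add: A_def)
      next
        case False
        then have "n < j" using j r_mono[of j n] by linarith
        then obtain k where k: "j = Suc (k + n)"
          using less_iff_Suc_add[of n j] by (auto simp: add.commute)
        have "\<not> r (k + n) \<le> h x"
          using not_less_Least[of "k + n" "\<lambda>j. r j \<le> h x"] k unfolding j_def by auto
        then have "x \<in> D (k + n)" using x j k by (auto simp: D_def)
        then show ?thesis by blast
      qed
    qed
    then have "?\<mu> (X - F) \<le> ?\<mu> (A n \<union> (\<Union>k. D (k + n)))"
      by (rule hausdorff_outer_mono)
    also have "\<dots> \<le> ?\<mu> (A n) + ?\<mu> (\<Union>k. D (k + n))"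
      by (rule hausdorff_outer_Un)
    also have "\<dots> \<le> ?\<mu> (A n) + (\<Sum>k. ?\<mu> (D (k + n)))"
      by (intro add_left_mono hausdorff_outer_subadditive)
    finally show ?thesis .
  qed
  have near: "?\<mu> (X \<inter> F) + ?\<mu> (A n) \<le> ?\<mu> X" for n
  proof -
    have "?\<mu> (X \<inter> F) + ?\<mu> (A n) \<le> ?\<mu> ((X \<inter> F) \<union> A n)"
    proof (rule hausdorff_outer_separated[OF r_pos[of n]])
      fix x y assume "x \<in> X \<inter> F" "y \<in> A n"
      then have "h x = 0" "r n \<le> h y" by (auto simp: h_def A_def)
      then show "r n \<le> dist x y" using h_le[of y x] by (simp add: dist_commute)
    qed
    also have "\<dots> \<le> ?\<mu> X"
      by (rule hausdorff_outer_mono) (auto simp: A_def)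
    finally show ?thesis .
  qed
  have bound: "?\<mu> (X \<inter> F) + ?\<mu> (X - F) \<le> ?\<mu> X + (\<Sum>k. ?\<mu> (D (k + n)))" for n
  proof -
    have "?\<mu> (X \<inter> F) + ?\<mu> (X - F) \<le> ?\<mu> (X \<inter> F) + (?\<mu> (A n) + (\<Sum>k. ?\<mu> (D (k + n))))"
      by (intro add_left_mono split)
    also have "\<dots> \<le> ?\<mu> X + (\<Sum>k. ?\<mu> (D (k + n)))"
      unfolding add.assoc[symmetric] by (intro add_right_mono near)
    finally show ?thesis .
  qed
  have tail: "(\<lambda>n. \<Sum>k. ?\<mu> (D (k + n))) \<longlonglongrightarrow> 0"
  proof -
    define d where "d = (\<lambda>k. enn2real (?\<mu> (D k)))"
    have d: "?\<mu> (D k) = ennreal (d k)" "0 \<le> d k" for k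
      using D_fin[of k] by (auto simp: d_def less_top)
    have sd: "summable d"
      using sums by (intro summable_suminf_not_top) (auto simp: d)
    have "(\<lambda>n. \<Sum>k. d (k + n)) \<longlonglongrightarrow> 0"
      by (rule suminf_exist_split2[OF sd])
    moreover have "(\<Sum>k. ?\<mu> (D (k + n))) = ennreal (\<Sum>k. d (k + n))" for n
      unfolding d using sd by (intro suminf_ennreal2) (auto simp: d summable_iff_shift)
    ultimately show ?thesis
      by (auto dest: tendsto_ennrealI)
  qed
  have "(\<lambda>n. ?\<mu> X + (\<Sum>k. ?\<mu> (D (k + n)))) \<longlonglongrightarrow> ?\<mu> X + 0"
    by (intro tendsto_add tendsto_const tail)
  then show ?thesis
    using bound by (auto intro: LIMSEQ_le_const)
qed

lemma outer_measure_space_hausdorff: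
  "outer_measure_space UNIV (hausdorff_outer a)"
  by (auto simp: outer_measure_space_def positive_def increasing_def countably_subadditive_def
      hausdorff_outer_empty intro: hausdorff_outer_mono hausdorff_outer_subadditive)

lemma measure_space_hausdorff:
  "measure_space (UNIV :: 'a::metric_space set) (sets borel) (hausdorff_outer a)"
proof -
  let ?L = "lambda_system (UNIV :: 'a set) UNIV (hausdorff_outer a)"
  interpret P: sigma_algebra "UNIV :: 'a set" UNIV
    using sigma_algebra_Pow[of "UNIV :: 'a set"] by simp
  have L: "measure_space UNIV ?L (hausdorff_outer a)"
    by (rule P.caratheodory_lemma[OF outer_measure_space_hausdorff])
  have "F \<in> ?L" if "closed F" for F :: "'a set"
    unfolding P.lambda_system_eq
    using closed_hausdorff_outer_measurable[OF that, of a] hausdorff_outer_Un[of a "_ \<inter> F" "_ - F"]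
    by (auto intro!: antisym) (metis Un_Diff_Int Un_commute)
  then have "sigma_sets UNIV (Collect closed) \<subseteq> ?L"
    using L by (intro sigma_algebra.sigma_sets_subset) (auto simp: measure_space_def)
  then have sub: "sets (borel :: 'a measure) \<subseteq> ?L"
    by (simp add: borel_eq_closed)
  show ?thesis
    using L sub sets.sigma_algebra_axioms[of "borel :: 'a measure"]
    by (auto simp: measure_space_def positive_def countably_additive_def)
qed

lemma sets_hausdorff_measure: "sets (hausdorff_measure a) = sets borel"
  using sets.sigma_sets_eq[of borel] by (simp add: hausdorff_measure_def)

lemma space_hausdorff_measure: "space (hausdorff_measure a) = UNIV"
  by (simp add: hausdorff_measure_def)

lemma emeasure_hausdorff_measure:
  fixes A :: "'a::metric_space set"
  assumes "A \<in> sets borel"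
  shows "emeasure (hausdorff_measure a) A = hausdorff_outer a A"
proof (rule emeasure_measure_of[OF hausdorff_measure_def])
  show "A \<in> sets (hausdorff_measure a)" using assms by (simp add: sets_hausdorff_measure)
qed (use measure_space_hausdorff[where 'a = 'a, of a] in
      \<open>auto simp: measure_space_def sets_hausdorff_measure\<close>)

section \<open>Transforms, isotropy and regularity\<close>

definition equator :: "real ^ 'n \<Rightarrow> (real ^ 'n) set" where
  "equator u = sphere 0 1 \<inter> {x. x \<bullet> u = 0}"

text \<open>
  The formula is taken for all vectors \<open>u\<close>, not only unit vectors, so that the transform is a
  positively homogeneous function of degree one on the whole space.
\<close>

definition cosine_transform :: "(real ^ 'n \<Rightarrow> real) \<Rightarrow> real ^ 'n \<Rightarrow> real" where
  "cosine_transform g u =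
     (LINT x:sphere 0 1|hausdorff_measure (CARD('n) - 1). \<bar>x \<bullet> u\<bar> * g x)"

definition funk_transform :: "(real ^ 'n \<Rightarrow> real) \<Rightarrow> real ^ 'n \<Rightarrow> real" where
  "funk_transform g u = (LINT x:equator u|hausdorff_measure (CARD('n) - 2). g x)"

definition isotropic_on_equator :: "(real ^ 'n \<Rightarrow> real) \<Rightarrow> real ^ 'n \<Rightarrow> bool" where
  "isotropic_on_equator g u \<longleftrightarrow>
     (\<lambda>v. LINT x:equator u|hausdorff_measure (CARD('n) - 2). (x \<bullet> v)\<^sup>2 * g x)
       constant_on equator u"

definition grassmannian :: "nat \<Rightarrow> (real ^ 'n) set set" where
  "grassmannian k = {H. subspace H \<and> dim H = k}"

definition C2_on :: "('a::real_normed_vector \<Rightarrow> 'b::real_normed_vector) \<Rightarrow> 'a set \<Rightarrow> bool" where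
  "C2_on f S \<longleftrightarrow>
     (\<exists>(f' :: 'a \<Rightarrow> 'a \<Rightarrow>\<^sub>L 'b) (f'' :: 'a \<Rightarrow> 'a \<Rightarrow>\<^sub>L 'a \<Rightarrow>\<^sub>L 'b).
        (\<forall>x\<in>S. (f has_derivative blinfun_apply (f' x)) (at x)) \<and>
        (\<forall>x\<in>S. (f' has_derivative blinfun_apply (f'' x)) (at x)) \<and>
        continuous_on S f'')"

text \<open>
  Isotropy on an open set determines the Funk transform only up to one constant for each component:
  an even function that equals the norm near one pair of antipodal points and twice the norm near
  another is a cosine transform of a smooth density with different Funk transforms near the two
  pairs. Constancy is therefore stated on components, which for a connected set is plain constancy.
\<close>

lemma constant_on_components_connected:
  assumes "connected U"
  shows "(\<forall>V\<in>components U. f constant_on V) \<longleftrightarrow> f constant_on U"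
proof (cases "U = {}")
  case False
  then have "components U = {U}" using assms by (simp add: components_eq_sing_iff)
  then show ?thesis by simp
qed (simp add: constant_on_def)

end

theory Submission
  imports Defs
begin

text \<open>
  For \<open>v\<close> in \<open>H\<close> consider a function \<open>F\<close> whose derivative at \<open>u\<close> in direction \<open>w\<close> is the
  integral over the hyperplane orthogonal to \<open>u\<close> of \<open>(x \<bullet> v) * (x \<bullet> w) * g (sgn x)\<close> times a radial
  weight; up to the weight this is the derivative in direction \<open>v\<close> of the cosine transform. Isotropy at \<open>u\<close> turns
  this derivative into \<open>\<mu> u * (v \<bullet> w)\<close> for \<open>w\<close> orthogonal to \<open>u\<close>, where \<open>\<mu> u\<close> is a fixed multiple of the
  Funk transform at \<open>u\<close>. Hence \<open>F\<close> is constant along the small circles on which \<open>u \<bullet> v\<close> is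
  constant, and its transversal derivative \<open>\<mu>\<close> is constant along the great circle orthogonal to \<open>v\<close>.
  As \<open>dim H \<ge> 3\<close>, any two points of \<open>H\<close> lie on such a great circle.

  The Hausdorff measure on an equator enters only through its finiteness and its invariance under
  reflections, which determine it up to a factor.
\<close>

section \<open>Reflections and Lebesgue measure\<close>

text \<open>Isotropy at \<open>u\<close> says that the Hessian of the cosine transform acts on the
  hyperplane orthogonal to \<open>u\<close> as a multiple of the identity. The obstacle is to reach
  such derivatives from a Hausdorff measure without polar coordinates. The potential is therefore a
  Lebesgue integral: differentiating the integral of a function over a half space gives an integral
  over the bounding hyperplane. Slicing along a fixed unit vector \<open>e\<close> with
  \<open>e \<bullet> u = 1\<close> reduces this to the fundamental theorem of calculus and
  differentiation under the integral sign. Hyperplane integrals are kept as integrals over the whole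
  space, with the continuous bump \<open>tent\<close> in the transversal variable; radial projection
  then yields a measure on the equator that can be compared with the Hausdorff measure. The price is
  twofold. Directions are represented by vectors of the affine hyperplane
  \<open>e \<bullet> u = 1\<close> instead of unit vectors, and the comparison factor depends on the
  norm of \<open>u\<close>, so the final comparison is made at two vectors of equal norm.\<close>

lemma nn_integral_lborel_translation:
  fixes f :: "'a::euclidean_space \<Rightarrow> ennreal"
  assumes [measurable]: "f \<in> borel_measurable borel"
  shows "(\<integral>\<^sup>+x. f (c + x) \<partial>lborel) = (\<integral>\<^sup>+x. f x \<partial>lborel)"
  by (subst (2) lborel_distr_plus[symmetric, of c], subst nn_integral_distr) auto

text \<open>The image of \<open>lborel\<close> under a linear map is translation invariant, hence a multiple of
  \<open>lborel\<close>, and for an involution the factor squares to one. The library's determinant formula is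
  unavailable because it needs a well-ordered index type.\<close>

lemma lborel_distr_involution:
  fixes L :: "'a::euclidean_space \<Rightarrow> 'a"
  assumes lin: "linear L" and inv: "\<And>x. L (L x) = x"
  shows "distr lborel borel L = lborel"
proof -
  have meas [measurable]: "L \<in> borel_measurable borel"
    using lin by (intro borel_measurable_continuous_onI linear_continuous_on)
      (simp add: linear_conv_bounded_linear)
  define B :: "'a set" where "B = box 0 One"
  have [measurable]: "B \<in> sets borel" by (simp add: B_def)
  have B1: "emeasure lborel B = 1"
    by (simp add: B_def emeasure_lborel_box_eq)
  define c where "c = (\<integral>\<^sup>+x. indicator B (- L x) \<partial>lborel)"
  have key: "(\<integral>\<^sup>+x. indicator A (L x) \<partial>lborel) = c * emeasure lborel A"
    if [measurable]: "A \<in> sets borel" for A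
  proof -
    \<comment> \<open>A factor 1 is inserted, namely the mass of a translate of \<open>B\<close>.
      After Fubini, the shift of \<open>x\<close> by \<open>L y\<close> moves \<open>y\<close> from
      the factor of \<open>B\<close> to that of \<open>A\<close>, because
      \<open>L (L y) = y\<close>.\<close>
    have "(\<integral>\<^sup>+x. indicator A (L x) \<partial>lborel)
        = (\<integral>\<^sup>+x. indicator A (L x) * (\<integral>\<^sup>+y. indicator B (- L x + y) \<partial>lborel) \<partial>lborel)"
      by (subst nn_integral_lborel_translation) (simp_all add: B1)
    also have "\<dots> = (\<integral>\<^sup>+x. (\<integral>\<^sup>+y. indicator A (L x) * indicator B (- L x + y) \<partial>lborel) \<partial>lborel)"
      by (subst nn_integral_cmult) auto
    also have "\<dots> = (\<integral>\<^sup>+y. (\<integral>\<^sup>+x. indicator A (L x) * indicator B (- L x + y) \<partial>lborel) \<partial>lborel)"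
      by (rule lborel_pair.Fubini'[symmetric]) measurable
    also have "\<dots> = (\<integral>\<^sup>+y. (\<integral>\<^sup>+x. indicator A (y + L x) * indicator B (- L x) \<partial>lborel) \<partial>lborel)"
    proof (rule nn_integral_cong)
      fix y
      show "(\<integral>\<^sup>+x. indicator A (L x) * indicator B (- L x + y) \<partial>lborel)
          = (\<integral>\<^sup>+x. indicator A (y + L x) * indicator B (- L x) \<partial>lborel)"
        using nn_integral_lborel_translation
          [of "\<lambda>x. indicator A (L x) * indicator B (- L x + y)" "L y", symmetric]
        by (simp add: linear_add[OF lin] inv)
    qed
    also have "\<dots> = (\<integral>\<^sup>+x. (\<integral>\<^sup>+y. indicator A (y + L x) * indicator B (- L x) \<partial>lborel) \<partial>lborel)"
      by (rule lborel_pair.Fubini') measurable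
    also have "\<dots> = (\<integral>\<^sup>+x. (\<integral>\<^sup>+y. indicator A (L x + y) \<partial>lborel) * indicator B (- L x) \<partial>lborel)"
      by (subst nn_integral_multc) (auto simp: add.commute)
    also have "\<dots> = emeasure lborel A * c"
      unfolding c_def by (subst nn_integral_lborel_translation) (auto simp: nn_integral_cmult)
    finally show ?thesis by (simp add: mult.commute)
  qed
  have em: "emeasure (distr lborel borel L) A = c * emeasure lborel A" if [measurable]: "A \<in> sets borel" for A
  proof -
    have "emeasure (distr lborel borel L) A = (\<integral>\<^sup>+x. indicator A x \<partial>distr lborel borel L)"
      by simp
    also have "\<dots> = (\<integral>\<^sup>+x. indicator A (L x) \<partial>lborel)"
      by (rule nn_integral_distr) auto
    finally show ?thesis by (simp only: key[OF that])
  qed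
  have "L -` B \<in> sets borel"
    using measurable_sets_borel[OF meas, of B] by simp
  then have "c * emeasure lborel (L -` B) = (\<integral>\<^sup>+x. indicator (L -` B) (L x) \<partial>lborel)"
    by (rule key[symmetric])
  also have "\<dots> = (\<integral>\<^sup>+x. indicator B x \<partial>lborel)"
    by (rule nn_integral_cong) (simp add: indicator_def inv)
  also have "\<dots> = emeasure lborel B" by simp
  finally have "emeasure lborel B = c * emeasure lborel (L -` B)" by simp
  also have "emeasure lborel (L -` B) = c * emeasure lborel B"
    using em[of B] by (simp add: emeasure_distr)
  finally have "emeasure lborel B = c * (c * emeasure lborel B)" .
  then have "c * c = 1" by (simp add: B1)
  then have "c = 1"
    by (cases c) (auto simp: ennreal_mult'[symmetric] square_eq_1_iff ennreal_top_mult)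
  then show ?thesis
    using em by (intro measure_eqI) auto
qed

text \<open>The condition on \<open>b\<close> and \<open>y\<close> is exactly what makes the map an
  involution. For \<open>b\<close> parallel to \<open>y\<close> it is an orthogonal reflection; the
  oblique case serves to change the direction of a projection.\<close>

lemma lborel_distr_oblique_reflection:
  fixes b y :: "'a::euclidean_space"
  assumes "b \<bullet> y = 2"
  shows "distr lborel borel (\<lambda>x. x - (x \<bullet> y) *\<^sub>R b) = lborel"
proof (rule lborel_distr_involution)
  show "linear (\<lambda>x. x - (x \<bullet> y) *\<^sub>R b)"
    by (rule linearI) (auto simp: algebra_simps)
  show "x - (x \<bullet> y) *\<^sub>R b - ((x - (x \<bullet> y) *\<^sub>R b) \<bullet> y) *\<^sub>R b = x" for x
    using assms by (simp add: inner_diff_left scaleR_left_diff_distrib)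
qed

text \<open>Division by zero makes this the identity for \<open>d = 0\<close>, so that the
  reflection along \<open>a - b\<close> carries \<open>a\<close> to \<open>b\<close> for any two
  vectors of equal norm, equal or not.\<close>

definition hyperplane_reflection :: "'a::real_inner \<Rightarrow> 'a \<Rightarrow> 'a" where
  "hyperplane_reflection d x = x - (x \<bullet> d) *\<^sub>R ((2 / (d \<bullet> d)) *\<^sub>R d)"

lemma hyperplane_reflection_diff:
  "hyperplane_reflection d (x - y) = hyperplane_reflection d x - hyperplane_reflection d y"
  unfolding hyperplane_reflection_def inner_diff_left scaleR_left_diff_distrib by simp

lemma hyperplane_reflection_scale:
  "hyperplane_reflection d (c *\<^sub>R x) = c *\<^sub>R hyperplane_reflection d x"
  by (simp add: hyperplane_reflection_def scaleR_diff_right mult.assoc)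

lemma hyperplane_reflection_alt:
  assumes "d \<noteq> 0"
  obtains c where "c * (d \<bullet> d) = 2" "\<And>x. hyperplane_reflection d x = x - (c * (x \<bullet> d)) *\<^sub>R d"
proof
  show "2 / (d \<bullet> d) * (d \<bullet> d) = 2" using assms by simp
qed (simp add: hyperplane_reflection_def mult.commute)

lemma inner_hyperplane_reflection:
  "hyperplane_reflection d x \<bullet> hyperplane_reflection d y = x \<bullet> y"
proof (cases "d = 0")
  case False
  then obtain c where c: "c * (d \<bullet> d) = 2"
      and R: "\<And>x. hyperplane_reflection d x = x - (c * (x \<bullet> d)) *\<^sub>R d"
    using hyperplane_reflection_alt by blast
  have "hyperplane_reflection d x \<bullet> hyperplane_reflection d y
      = x \<bullet> y - 2 * c * (x \<bullet> d) * (y \<bullet> d) + c * (d \<bullet> d) * (c * (x \<bullet> d) * (y \<bullet> d))"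
    unfolding R inner_diff_left inner_diff_right inner_scaleR_left inner_scaleR_right
    by (simp add: inner_commute[of d y] algebra_simps)
  then show ?thesis unfolding c by simp
qed (simp add: hyperplane_reflection_def)

lemma norm_hyperplane_reflection [simp]: "norm (hyperplane_reflection d x) = norm x"
  by (simp add: norm_eq_sqrt_inner inner_hyperplane_reflection)

lemma dist_hyperplane_reflection [simp]:
  "dist (hyperplane_reflection d x) (hyperplane_reflection d y) = dist x y"
  by (simp add: dist_norm flip: hyperplane_reflection_diff)

lemma hyperplane_reflection_involution [simp]:
  "hyperplane_reflection d (hyperplane_reflection d x) = x"
proof (cases "d = 0")
  case False
  then obtain c where c: "c * (d \<bullet> d) = 2"
      and R: "\<And>x. hyperplane_reflection d x = x - (c * (x \<bullet> d)) *\<^sub>R d"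
    using hyperplane_reflection_alt by blast
  have "c * ((x - (c * (x \<bullet> d)) *\<^sub>R d) \<bullet> d) = c * (x \<bullet> d) - c * (d \<bullet> d) * (c * (x \<bullet> d))"
    by (simp add: inner_diff_left algebra_simps)
  then have "c * ((x - (c * (x \<bullet> d)) *\<^sub>R d) \<bullet> d) = - (c * (x \<bullet> d))" unfolding c by simp
  then have "hyperplane_reflection d (x - (c * (x \<bullet> d)) *\<^sub>R d) = x"
    unfolding R[of "x - (c * (x \<bullet> d)) *\<^sub>R d"] by (simp only: scaleR_minus_left) simp
  then show ?thesis by (simp only: R[of x])
qed (simp add: hyperplane_reflection_def)

lemma hyperplane_reflection_orth: "x \<bullet> d = 0 \<Longrightarrow> hyperplane_reflection d x = x"
  by (simp add: hyperplane_reflection_def)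

lemma hyperplane_reflection_swap:
  assumes "norm a = norm b"
  shows "hyperplane_reflection (a - b) a = b"
proof (cases "a = b")
  case False
  have aa: "a \<bullet> a = b \<bullet> b" using assms by (simp add: dot_square_norm)
  have h: "(a - b) \<bullet> (a - b) = 2 * (a \<bullet> (a - b))"
    using aa by (simp add: inner_diff_left inner_diff_right inner_commute)
  have "a \<bullet> (a - b) \<noteq> 0"
    using h False by (metis inner_eq_zero_iff mult_zero_right right_minus_eq)
  then have "(a \<bullet> (a - b)) * (2 / ((a - b) \<bullet> (a - b))) = 1"
    unfolding h by simp
  then have "hyperplane_reflection (a - b) a = a - 1 *\<^sub>R (a - b)"
    unfolding hyperplane_reflection_def scaleR_scaleR by (simp only:)
  then show ?thesis by simp
qed (simp add: hyperplane_reflection_def)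

lemma continuous_hyperplane_reflection: "continuous_on S (hyperplane_reflection d)"
  unfolding hyperplane_reflection_def by (intro continuous_intros)

lemma measurable_hyperplane_reflection [measurable]:
  "(hyperplane_reflection d :: 'a::euclidean_space \<Rightarrow> 'a) \<in> borel_measurable borel"
  by (intro borel_measurable_continuous_onI continuous_hyperplane_reflection)

lemma lborel_distr_hyperplane_reflection:
  "distr lborel borel (hyperplane_reflection (d :: 'a::euclidean_space)) = lborel"
proof (cases "d = 0")
  case True
  then have "hyperplane_reflection d = (\<lambda>x. x)" by (auto simp: hyperplane_reflection_def)
  then show ?thesis by (simp add: distr_id2)
next
  case False
  then show ?thesis
    unfolding hyperplane_reflection_def[abs_def] by (intro lborel_distr_oblique_reflection) simp
qed

section \<open>Hausdorff measure of equators\<close>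

lemma hausdorff_content_isometry:
  fixes R :: "'a::metric_space \<Rightarrow> 'b::metric_space"
  assumes iso: "\<And>x y. dist (R x) (R y) = dist x y"
  shows "hausdorff_content a \<delta> (R ` A) \<le> hausdorff_content a \<delta> A"
  unfolding hausdorff_content_def[of a \<delta> A]
proof (rule INF_greatest, safe)
  fix C :: "nat \<Rightarrow> 'a set"
  assume C: "A \<subseteq> (\<Union>i. C i)" "\<forall>i. bounded (C i) \<and> diameter (C i) \<le> \<delta>"
  have "(\<lambda>(x, y). dist x y) ` (R ` X \<times> R ` X) = (\<lambda>(x, y). dist x y) ` (X \<times> X)" for X
    by (force simp: image_iff iso)
  then have diam: "diameter (R ` C i) = diameter (C i)" for i
    by (simp add: diameter_def)
  have bdd: "bounded (R ` C i)" for i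
  proof -
    obtain x r where "\<forall>y\<in>C i. dist x y \<le> r" using C(2) unfolding bounded_def by meson
    then have "\<forall>y\<in>R ` C i. dist (R x) y \<le> r" by (simp add: iso)
    then show ?thesis unfolding bounded_def by blast
  qed
  have "hausdorff_content a \<delta> (R ` A) \<le> (\<Sum>i. hausdorff_weight a (R ` C i))"
    using C bdd by (intro hausdorff_content_le) (auto simp: diam, blast)
  also have "\<dots> = (\<Sum>i. hausdorff_weight a (C i))"
    by (intro suminf_cong) (auto simp: hausdorff_weight_def diam)
  finally show "hausdorff_content a \<delta> (R ` A) \<le> (\<Sum>i. hausdorff_weight a (C i))" .
qed

lemma hausdorff_outer_isometry:
  assumes "\<And>x y. dist (R x) (R y) = dist x y"
  shows "hausdorff_outer a (R ` A) \<le> hausdorff_outer a A"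
  unfolding hausdorff_outer_def using hausdorff_content_isometry[OF assms]
  by (intro SUP_mono) auto

lemma hausdorff_outer_reflection:
  "hausdorff_outer a (hyperplane_reflection d ` A) = hausdorff_outer a A"
proof (rule antisym)
  have "A = hyperplane_reflection d ` hyperplane_reflection d ` A"
    by (simp add: image_image)
  then show "hausdorff_outer a A \<le> hausdorff_outer a (hyperplane_reflection d ` A)"
    using hausdorff_outer_isometry[of "hyperplane_reflection d" a "hyperplane_reflection d ` A"] by simp
qed (simp add: hausdorff_outer_isometry)

text \<open>The cover is padded to a sequence with empty sets, whose weight is 0 in every
  dimension.\<close>

lemma hausdorff_content_finite_cover:
  assumes I: "finite I" and A: "A \<subseteq> (\<Union>i\<in>I. C i)" and \<delta>: "0 \<le> \<delta>"
    and "\<And>i. i \<in> I \<Longrightarrow> bounded (C i)" "\<And>i. i \<in> I \<Longrightarrow> diameter (C i) \<le> \<delta>"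
  shows "hausdorff_content a \<delta> A \<le> (\<Sum>i\<in>I. hausdorff_weight a (C i))"
proof -
  obtain h where h: "bij_betw h {0..<card I} I"
    using ex_bij_betw_nat_finite[OF I] by blast
  define D where "D = (\<lambda>k. if k < card I then C (h k) else {})"
  have hI: "k < card I \<Longrightarrow> h k \<in> I" for k
    using h by (auto simp: bij_betw_def)
  have "hausdorff_content a \<delta> A \<le> (\<Sum>k. hausdorff_weight a (D k))"
  proof (rule hausdorff_content_le)
    show "A \<subseteq> (\<Union>k. D k)"
    proof
      fix x assume "x \<in> A"
      then obtain i where "i \<in> I" "x \<in> C i" using A by auto
      moreover from this obtain k where "k < card I" "h k = i"
        using bij_betw_imp_surj_on[OF h] by force
      ultimately show "x \<in> (\<Union>k. D k)" by (auto simp: D_def)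
    qed
    show "bounded (D k)" "diameter (D k) \<le> \<delta>" for k
      using assms hI by (auto simp: D_def)
  qed
  also have "\<dots> = (\<Sum>k<card I. hausdorff_weight a (D k))"
    by (intro suminf_finite) (auto simp: D_def)
  also have "\<dots> = (\<Sum>k\<in>{0..<card I}. hausdorff_weight a (C (h k)))"
    by (intro sum.cong) (auto simp: D_def)
  also have "\<dots> = (\<Sum>i\<in>I. hausdorff_weight a (C i))"
    by (rule sum.reindex_bij_betw[OF h])
  finally show ?thesis .
qed

lemma equator_scale: "c \<noteq> 0 \<Longrightarrow> equator (c *\<^sub>R u) = equator u"
  by (auto simp: equator_def)

lemma equator_reflection:
  assumes "norm a = norm b"
  shows "hyperplane_reflection (a - b) ` equator a = equator b"
proof -
  let ?R = "hyperplane_reflection (a - b)"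
  have Ra: "?R a = b" by (rule hyperplane_reflection_swap[OF assms])
  have "?R x \<bullet> b = x \<bullet> a" "?R x \<bullet> a = x \<bullet> b" for x
    using inner_hyperplane_reflection[of "a - b" x a] inner_hyperplane_reflection[of "a - b" "?R x" a]
    by (simp_all add: Ra)
  then have "?R ` equator a \<subseteq> equator b" "?R ` equator b \<subseteq> equator a"
    by (auto simp: equator_def)
  then show ?thesis
    by (metis hyperplane_reflection_involution image_eqI subsetD subsetI subset_antisym)
qed

text \<open>For norms \<open>a\<close>, \<open>b\<close> and cosine \<open>c\<close> of the angle,
  the squared distances are \<open>2 * (1 - c)\<close> and
  \<open>(a - b)^2 + 2 * a * b * (1 - c)\<close>.\<close>

lemma dist_normalize_le:
  fixes x y :: "'a::real_inner"
  assumes "1 \<le> norm x" "1 \<le> norm y"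
  shows "dist (x /\<^sub>R norm x) (y /\<^sub>R norm y) \<le> dist x y"
proof -
  define a b c where "a = norm x" "b = norm y" "c = (x \<bullet> y) / (a * b)"
  have ab: "a \<ge> 1" "b \<ge> 1" using assms by (auto simp: a_b_c_def)
  then have xy: "x \<bullet> y = a * b * c" by (auto simp: a_b_c_def)
  have "\<bar>x \<bullet> y\<bar> \<le> a * b" unfolding a_b_c_def by (rule Cauchy_Schwarz_ineq2)
  then have c: "c \<le> 1" using ab by (simp add: a_b_c_def(3) divide_le_eq abs_le_iff mult_pos_pos)
  have xx: "x \<bullet> x = a\<^sup>2" "y \<bullet> y = b\<^sup>2" by (simp_all add: a_b_c_def dot_square_norm)
  have "(dist (x /\<^sub>R a) (y /\<^sub>R b))\<^sup>2 = 2 - 2 * c"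
    using ab unfolding dist_norm dot_square_norm[symmetric]
    by (simp add: inner_diff_left inner_diff_right inner_commute[of y x] xx xy field_simps power2_eq_square)
  also have "\<dots> \<le> 2 * (a * b) * (1 - c)"
  proof -
    have "1 \<le> a * b" using ab mult_mono[of 1 a 1 b] by simp
    then have "1 * (1 - c) \<le> (a * b) * (1 - c)" using c by (intro mult_right_mono) auto
    then show ?thesis by simp
  qed
  also have "\<dots> \<le> 2 * (a * b) * (1 - c) + (a - b)\<^sup>2" by simp
  also have "\<dots> = (dist x y)\<^sup>2"
    unfolding dist_norm dot_square_norm[symmetric]
    by (simp add: inner_diff_left inner_diff_right inner_commute[of y x] xx xy power2_eq_square algebra_simps)
  finally have "dist (x /\<^sub>R a) (y /\<^sub>R b) \<le> dist x y"
    by (rule power2_le_imp_le) simp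
  then show ?thesis unfolding a_b_c_def .
qed

lemma unit_interval_grid:
  fixes t :: real and N :: nat
  assumes "0 \<le> t" "t \<le> 1" "0 < N"
  obtains k where "k < N" "real k / N \<le> t" "t \<le> (real k + 1) / N"
proof (cases "t = 1")
  case True
  \<comment> \<open>The right end point has floor \<open>N\<close>, which is out of range; it is
    assigned to the last cell.\<close>
  show ?thesis
    by (rule that[of "N - 1"]) (use True assms in \<open>auto simp: field_simps of_nat_diff\<close>)
next
  case False
  define k where "k = nat \<lfloor>t * N\<rfloor>"
  have k: "real k \<le> t * N" "t * N < real k + 1"
    using assms by (auto simp: k_def)
  moreover have "t * N < N" using False assms by simp
  ultimately have "real k < real N" by linarith
  then show ?thesis
    by (intro that[of k]) (use k assms in \<open>auto simp: field_simps\<close>)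
qed

text \<open>The equator is the radial projection, which does not increase distances, of the facets of a
  cube of dimension \<open>CARD('n) - 1\<close>; each facet is cut into \<open>N ^ (CARD('n) - 2)\<close> small cubes.\<close>

lemma hausdorff_content_equator_axis:
  fixes i0 :: "'n::finite"
  assumes N: "0 < N" and card: "CARD('n) \<ge> 3"
  shows "hausdorff_content (CARD('n) - 2) (2 * CARD('n) / real N) (equator (axis i0 1 :: real ^ 'n))
     \<le> ennreal (2 * (CARD('n) - 1) * unit_ball_vol (real (CARD('n) - 2)) * CARD('n) ^ (CARD('n) - 2))"
proof -
  let ?n = "CARD('n)"
  define F where "F = (\<lambda>j. PiE (UNIV - {i0, j}) (\<lambda>_. {..<N}))"
  define I where "I = (SIGMA j:UNIV - {i0}. {-1, 1::real} \<times> F j)"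
  \<comment> \<open>The index names a facet \<open>y $ j = \<sigma>\<close> of the cube and a grid
    cell \<open>k\<close> on it; \<open>(y $ i + 1) / 2\<close> rescales the side from [-1,1] to
    [0,1].\<close>
  define Q :: "'n \<times> real \<times> ('n \<Rightarrow> nat) \<Rightarrow> (real ^ 'n) set" where
    "Q = (\<lambda>(j, \<sigma>, k). {y. y $ i0 = 0 \<and> y $ j = \<sigma> \<and>
        (\<forall>i\<in>UNIV - {i0, j}. real (k i) / N \<le> (y $ i + 1) / 2 \<and> (y $ i + 1) / 2 \<le> (real (k i) + 1) / N)})"
  define C where "C = (\<lambda>p. (\<lambda>y. y /\<^sub>R norm y) ` Q p)"
  have fin: "finite I" unfolding I_def F_def by (intro finite_SigmaI finite_cartesian_product finite_PiE) auto
  have cardF: "card (F j) = N ^ (?n - 2)" if "j \<noteq> i0" for j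
  proof -
    have "card (UNIV - {i0, j}) = ?n - 2"
      using that by (subst card_Diff_subset) auto
    then show ?thesis by (simp add: F_def card_PiE)
  qed
  have cardI: "card I = (?n - 1) * (2 * N ^ (?n - 2))"
  proof -
    have "card I = (\<Sum>j\<in>UNIV - {i0}. card ({-1, 1::real} \<times> F j))"
      unfolding I_def by (intro card_SigmaI) (auto simp: F_def intro!: finite_PiE)
    also have "\<dots> = (\<Sum>j\<in>UNIV - {i0}. 2 * N ^ (?n - 2))"
      by (intro sum.cong) (auto simp: card_cartesian_product cardF)
    finally show ?thesis by simp
  qed
  \<comment> \<open>A coordinate varies by at most \<open>2 / N\<close> within a cell, and the norm
    is bounded by the sum over all coordinates.\<close>
  have dist_C: "dist x x' \<le> 2 * ?n / N" if pI: "p \<in> I" and xC: "x \<in> C p" "x' \<in> C p" for p x x'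
  proof -
    obtain j \<sigma> k where p: "p = (j, \<sigma>, k)" by (cases p)
    then have j: "j \<noteq> i0" "\<bar>\<sigma>\<bar> = 1" using pI by (auto simp: I_def)
    obtain y y' where y: "x = y /\<^sub>R norm y" "x' = y' /\<^sub>R norm y'" "y \<in> Q p" "y' \<in> Q p"
      using xC by (auto simp: C_def)
    have n1: "1 \<le> norm z" if "z \<in> Q p" for z
      using component_le_norm_cart[of z j] j that by (auto simp: Q_def p)
    have "dist x x' \<le> dist y y'"
      unfolding y using n1 y by (intro dist_normalize_le) auto
    also have "\<dots> \<le> (\<Sum>i\<in>UNIV. \<bar>(y - y') $ i\<bar>)"
      unfolding dist_norm by (rule norm_le_l1_cart)
    also have "\<dots> \<le> (\<Sum>i\<in>(UNIV::'n set). 2 / N)"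
    proof (rule sum_mono)
      fix i
      show "\<bar>(y - y') $ i\<bar> \<le> 2 / N"
      proof (cases "i \<in> {i0, j}")
        case True
        then show ?thesis using y by (auto simp: Q_def p)
      next
        case False
        then have "real (k i) / N \<le> (y $ i + 1) / 2" "(y $ i + 1) / 2 \<le> (real (k i) + 1) / N"
          "real (k i) / N \<le> (y' $ i + 1) / 2" "(y' $ i + 1) / 2 \<le> (real (k i) + 1) / N"
          using y(3,4) unfolding Q_def p by auto
        then have "\<bar>(y $ i + 1) / 2 - (y' $ i + 1) / 2\<bar> \<le> (real (k i) + 1) / N - real (k i) / N"
          by linarith
        also have "\<dots> = 1 / N" by (simp add: add_divide_distrib)
        finally show ?thesis by (simp add: diff_divide_distrib[symmetric])
      qed
    qed
    also have "\<dots> = 2 * ?n / N" by simp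
    finally show ?thesis .
  qed
  have diam: "diameter (C p) \<le> 2 * ?n / N" if "p \<in> I" for p
    using dist_C[OF that] by (intro diameter_le) (auto simp: dist_norm)
  have bdd: "bounded (C p)" if "p \<in> I" for p
    using dist_C[OF that] unfolding bounded_def by (cases "C p = {}") blast+
  have cover: "equator (axis i0 1) \<subseteq> (\<Union>p\<in>I. C p)"
  proof
    fix x :: "real ^ 'n" assume "x \<in> equator (axis i0 1)"
    then have x: "norm x = 1" "x $ i0 = 0" by (auto simp: equator_def inner_axis)
    \<comment> \<open>Dividing by a coordinate of largest modulus places the point on a facet of the
      cube.\<close>
    have "Max (range (\<lambda>i. \<bar>x $ i\<bar>)) \<in> range (\<lambda>i. \<bar>x $ i\<bar>)"
      by (rule Max_in) auto
    then obtain j where "Max (range (\<lambda>i. \<bar>x $ i\<bar>)) = \<bar>x $ j\<bar>" by (rule imageE)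
    then have j: "\<bar>x $ i\<bar> \<le> \<bar>x $ j\<bar>" for i
      by (metis Max_ge finite_imageI finite rangeI)
    have xj: "\<bar>x $ j\<bar> > 0"
    proof (rule ccontr)
      assume "\<not> ?thesis"
      then have "x $ i = 0" for i using j[of i] by simp
      then have "x = 0" by (simp add: vec_eq_iff)
      then show False using x by simp
    qed
    then have jn: "j \<noteq> i0" using x by auto
    define y where "y = x /\<^sub>R \<bar>x $ j\<bar>"
    have "\<bar>y $ i\<bar> = \<bar>x $ i\<bar> / \<bar>x $ j\<bar>" for i
      by (simp add: y_def abs_mult divide_inverse mult.commute)
    then have y: "\<bar>y $ i\<bar> \<le> 1" for i using j[of i] xj by simp
    have "\<exists>k<N. real k / N \<le> (y $ i + 1) / 2 \<and> (y $ i + 1) / 2 \<le> (real k + 1) / N" for i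
    proof -
      have "0 \<le> (y $ i + 1) / 2" "(y $ i + 1) / 2 \<le> 1" using y[of i] by (auto simp: abs_le_iff)
      then show ?thesis using N by (rule unit_interval_grid) blast
    qed
    then obtain k where k: "\<And>i. k i < N"
        "\<And>i. real (k i) / N \<le> (y $ i + 1) / 2" "\<And>i. (y $ i + 1) / 2 \<le> (real (k i) + 1) / N"
      by metis
    define p where "p = (j, sgn (x $ j), restrict k (UNIV - {i0, j}))"
    have "p \<in> I" using xj jn k by (auto simp: p_def I_def F_def sgn_if)
    moreover have "y \<in> Q p"
      using xj jn x k by (auto simp: p_def Q_def y_def sgn_if)
    moreover have "y /\<^sub>R norm y = x" using xj x by (simp add: y_def)
    ultimately show "x \<in> (\<Union>p\<in>I. C p)" by (force simp: C_def)
  qed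
  have wt: "hausdorff_weight (?n - 2) (C p) \<le> ennreal (unit_ball_vol (real (?n - 2)) * (?n / N) ^ (?n - 2))"
    if "p \<in> I" for p
  proof -
    have "(diameter (C p) / 2) ^ (?n - 2) \<le> (?n / N) ^ (?n - 2)"
      using diam[OF that] diameter_ge_0[OF bdd[OF that]]
      by (intro power_mono) (auto simp: mult.commute)
    then show ?thesis
      by (auto simp: hausdorff_weight_def intro!: ennreal_leI mult_left_mono)
  qed
  have "hausdorff_content (?n - 2) (2 * ?n / real N) (equator (axis i0 1 :: real ^ 'n))
      \<le> (\<Sum>p\<in>I. hausdorff_weight (?n - 2) (C p))"
    using fin cover bdd diam by (intro hausdorff_content_finite_cover) auto
  also have "\<dots> \<le> (\<Sum>p\<in>I. ennreal (unit_ball_vol (real (?n - 2)) * (?n / N) ^ (?n - 2)))"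
    by (intro sum_mono wt)
  also have "\<dots> = ennreal (card I * (unit_ball_vol (real (?n - 2)) * (?n / N) ^ (?n - 2)))"
    by (simp add: ennreal_mult' ennreal_of_nat_eq_real_of_nat)
  \<comment> \<open>The powers of \<open>N\<close> in the number of pieces and in their weight
    cancel, so the bound does not depend on the mesh.\<close>
  also have "card I * (unit_ball_vol (real (?n - 2)) * (?n / N) ^ (?n - 2))
     = 2 * (?n - 1) * unit_ball_vol (real (?n - 2)) * ?n ^ (?n - 2)"
    using N by (simp add: cardI power_divide)
  finally show ?thesis .
qed

text \<open>A coordinate equator has contents bounded uniformly in \<delta>; any other equator is
  its image under a reflection.\<close>

lemma hausdorff_outer_equator_finite:
  fixes u :: "real ^ 'n"
  assumes u: "u \<noteq> 0" and card: "CARD('n) \<ge> 3"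
  shows "hausdorff_outer (CARD('n) - 2) (equator u) < \<infinity>"
proof -
  fix i0 :: 'n
  let ?a = "axis i0 1 :: real ^ 'n"
  let ?n = "CARD('n)"
  have "hausdorff_content (?n - 2) \<delta> (equator ?a)
      \<le> ennreal (2 * (?n - 1) * unit_ball_vol (real (?n - 2)) * ?n ^ (?n - 2))" if "0 < \<delta>" for \<delta>
  proof -
    obtain N :: nat where "2 * ?n / \<delta> < N" using reals_Archimedean2 by blast
    moreover have "0 \<le> 2 * ?n / \<delta>" using that by simp
    ultimately have "0 < N" by linarith
    moreover have "2 * ?n \<le> \<delta> * N"
      using \<open>2 * ?n / \<delta> < N\<close> that by (simp add: divide_less_eq mult.commute)
    ultimately have N: "0 < N" "2 * ?n / real N \<le> \<delta>" by (auto simp: divide_le_eq)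
    show ?thesis
      using hausdorff_content_antimono[OF N(2)] hausdorff_content_equator_axis[OF N(1) card, of i0]
      by (rule order_trans)
  qed
  then have "hausdorff_outer (?n - 2) (equator ?a)
      \<le> ennreal (2 * (?n - 1) * unit_ball_vol (real (?n - 2)) * ?n ^ (?n - 2))"
    unfolding hausdorff_outer_def by (intro SUP_least) auto
  then have fin: "hausdorff_outer (?n - 2) (equator ?a) < \<infinity>"
    by (rule order_le_less_trans) simp
  have "equator u = equator (u /\<^sub>R norm u)" using u by (simp add: equator_scale)
  also have "\<dots> = hyperplane_reflection (?a - u /\<^sub>R norm u) ` equator ?a"
    using u by (intro equator_reflection[symmetric]) simp
  finally show ?thesis using fin by (simp add: hausdorff_outer_reflection)
qed

section \<open>Proportionality of invariant measures on an equator\<close>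

text \<open>Christensen's argument: averaging \<open>f x - f y\<close> over the pairs of points at distance less than
  \<open>\<delta>\<close> shows that measures whose balls have masses independent of the centre are proportional.\<close>

lemma uniformly_distributed_proportional:
  fixes M N :: "'a::{metric_space, second_countable_topology} measure" and f :: "'a \<Rightarrow> real"
  assumes M: "finite_measure M" "sets M = sets borel" and N: "finite_measure N" "sets N = sets borel"
    and E: "compact E"
    and ballM: "\<And>x y r. x \<in> E \<Longrightarrow> y \<in> E \<Longrightarrow> measure M (ball x r \<inter> E) = measure M (ball y r \<inter> E)"
    and ballN: "\<And>x y r. x \<in> E \<Longrightarrow> y \<in> E \<Longrightarrow> measure N (ball x r \<inter> E) = measure N (ball y r \<inter> E)"
    and f: "continuous_on E f"
  shows "measure N E * (\<integral>x. indicator E x * f x \<partial>M) = measure M E * (\<integral>x. indicator E x * f x \<partial>N)"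
proof -
  interpret M: finite_measure M by fact
  interpret N: finite_measure N by fact
  interpret MN: pair_sigma_finite M N ..
  interpret P: finite_measure "M \<Otimes>\<^sub>M N" by (rule finite_measure_pair_measure[OF N(1) M(1)])
  have Eb [measurable]: "E \<in> sets borel" using E by (simp add: borel_compact)
  note [measurable_cong] = M(2) N(2)
  define F where "F = (\<lambda>x. indicator E x * f x)"
  have F [measurable]: "F \<in> borel_measurable borel"
    using borel_measurable_continuous_on_indicator[OF Eb f] by (simp add: F_def)
  obtain B where B: "\<And>x. x \<in> E \<Longrightarrow> \<bar>f x\<bar> \<le> B"
    using compact_imp_bounded[OF compact_continuous_image[OF f E]] by (auto simp: bounded_iff)
  have FB: "\<bar>F x\<bar> \<le> \<bar>B\<bar>" for x
    using B[of x] by (auto simp: F_def indicator_def)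
  have bound: "\<bar>measure N E * (\<integral>x. F x \<partial>M) - measure M E * (\<integral>x. F x \<partial>N)\<bar> \<le> \<epsilon> * (measure M E * measure N E)"
    if e: "\<epsilon> > 0" for \<epsilon>
  proof (cases "measure N E = 0")
    case True
    have "AE x in N. x \<notin> E" using True
      by (subst AE_iff_measurable[where N = E]) (auto simp: N.emeasure_eq_measure sets_eq_imp_space_eq[OF N(2)])
    then have "(\<integral>x. F x \<partial>N) = 0" by (intro integral_eq_zero_AE) (auto simp: F_def)
    then show ?thesis using True by simp
  next
    case False
    then have NE: "measure N E > 0" by (simp add: zero_less_measure_iff)
    obtain \<delta> where d: "\<delta> > 0" "\<And>x y. x \<in> E \<Longrightarrow> y \<in> E \<Longrightarrow> dist x y < \<delta> \<Longrightarrow> \<bar>f x - f y\<bar> < \<epsilon>"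
      using compact_uniformly_continuous[OF f E] e
      unfolding uniformly_continuous_on_def dist_real_def by metis
    obtain x0 where x0: "x0 \<in> E" using NE by (metis all_not_in_conv less_irrefl measure_empty)
    define k m where "k = measure N (ball x0 \<delta> \<inter> E)" and "m = measure M (ball x0 \<delta> \<inter> E)"
    \<comment> \<open>By compactness finitely many of these balls cover \<open>E\<close>; as all
      have mass \<open>k\<close>, a vanishing \<open>k\<close> would make \<open>E\<close>
      null.\<close>
    have kpos: "k > 0"
    proof (rule ccontr)
      assume "\<not> k > 0"
      then have k0: "k = 0" using measure_nonneg[of N "ball x0 \<delta> \<inter> E"] unfolding k_def by linarith
      obtain D where D: "D \<subseteq> E" "finite D" "E \<subseteq> (\<Union>x\<in>D. ball x \<delta>)"
        using compactE_image[OF E, of E "\<lambda>x. ball x \<delta>"] d(1) by (metis UN_I centre_in_ball open_ball subsetI)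
      have "measure N E = measure N (\<Union>x\<in>D. ball x \<delta> \<inter> E)"
        using D by (intro arg_cong[where f = "measure N"]) auto
      also have "\<dots> \<le> (\<Sum>x\<in>D. measure N (ball x \<delta> \<inter> E))"
        using D by (intro N.finite_measure_subadditive_finite) auto
      also have "\<dots> = 0"
        using D ballN[OF _ x0, of _ \<delta>] k0 by (intro sum.neutral) (auto simp: k_def)
      finally show False using NE by simp
    qed
    define J :: "'a \<Rightarrow> 'a \<Rightarrow> real" where
      "J = (\<lambda>x y. indicator E x * indicator E y * (if dist x y < \<delta> then 1 else 0))"
    have J [measurable]: "(\<lambda>p. J (fst p) (snd p)) \<in> borel_measurable (M \<Otimes>\<^sub>M N)"
      unfolding J_def by measurable
    have J01: "0 \<le> J x y" "J x y \<le> 1" for x y by (auto simp: J_def indicator_def)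
    have Jy: "(\<integral>y. J x y \<partial>N) = indicator E x * k" for x
    proof (cases "x \<in> E")
      case True
      then have "J x y = indicator (ball x \<delta> \<inter> E) y" for y by (auto simp: J_def indicator_def)
      then show ?thesis using True ballN[OF True x0, of \<delta>]
        by (simp add: k_def sets_eq_imp_space_eq[OF N(2)])
    qed (simp add: J_def)
    have Jx: "(\<integral>x. J x y \<partial>M) = indicator E y * m" for y
    proof (cases "y \<in> E")
      case True
      then have "J x y = indicator (ball y \<delta> \<inter> E) x" for x by (auto simp: J_def indicator_def dist_commute)
      then show ?thesis using True ballM[OF True x0, of \<delta>]
        by (simp add: m_def sets_eq_imp_space_eq[OF M(2)])
    qed (simp add: J_def)
    have bnd: "integrable (M \<Otimes>\<^sub>M N) (\<lambda>p. J (fst p) (snd p) * h p)"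
      if [measurable]: "h \<in> borel_measurable (M \<Otimes>\<^sub>M N)" and h: "\<And>p. \<bar>h p\<bar> \<le> C" for h C
    proof (rule P.integrable_const_bound[where B = C])
      have "\<bar>J x y * h p\<bar> \<le> C" for x y p
        using mult_mono[OF J01(2)[of x y] h[of p]] J01(1)[of x y] by (auto simp: abs_mult)
      then show "AE p in M \<Otimes>\<^sub>M N. norm (J (fst p) (snd p) * h p) \<le> C" by simp
    qed measurable
    have int1: "integrable (M \<Otimes>\<^sub>M N) (\<lambda>p. J (fst p) (snd p) * F (fst p))"
      by (rule bnd[where C = "\<bar>B\<bar>"]) (auto simp: FB)
    have int2: "integrable (M \<Otimes>\<^sub>M N) (\<lambda>p. J (fst p) (snd p) * F (snd p))"
      by (rule bnd[where C = "\<bar>B\<bar>"]) (auto simp: FB)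
    have int3: "integrable (M \<Otimes>\<^sub>M N) (\<lambda>p. J (fst p) (snd p))"
      using bnd[of "\<lambda>_. 1" 1] by simp
    have I1: "(\<integral>p. J (fst p) (snd p) * F (fst p) \<partial>(M \<Otimes>\<^sub>M N)) = k * (\<integral>x. F x \<partial>M)"
    proof -
      have "(\<integral>p. J (fst p) (snd p) * F (fst p) \<partial>(M \<Otimes>\<^sub>M N)) = (\<integral>x. (\<integral>y. J x y * F x \<partial>N) \<partial>M)"
        using MN.integral_fst'[OF int1] by simp
      also have "\<dots> = (\<integral>x. k * F x \<partial>M)"
        by (intro Bochner_Integration.integral_cong) (auto simp: Jy F_def indicator_def)
      finally show ?thesis by simp
    qed
    have I2: "(\<integral>p. J (fst p) (snd p) * F (snd p) \<partial>(M \<Otimes>\<^sub>M N)) = m * (\<integral>x. F x \<partial>N)"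
    proof -
      have "(\<integral>p. J (fst p) (snd p) * F (snd p) \<partial>(M \<Otimes>\<^sub>M N)) = (\<integral>y. (\<integral>x. J x y * F y \<partial>M) \<partial>N)"
        using MN.integral_snd[of "\<lambda>x y. J x y * F y"] int2 by (simp add: case_prod_beta')
      also have "\<dots> = (\<integral>y. m * F y \<partial>N)"
        by (intro Bochner_Integration.integral_cong) (auto simp: Jx F_def indicator_def)
      finally show ?thesis by simp
    qed
    \<comment> \<open>Together with \<open>I4\<close> this gives
      \<open>k * measure M E = m * measure N E\<close>, which is used below to eliminate
      \<open>m\<close>.\<close>
    have I3: "(\<integral>p. J (fst p) (snd p) \<partial>(M \<Otimes>\<^sub>M N)) = k * measure M E"
      using MN.integral_fst'[OF int3] by (simp add: Jy sets_eq_imp_space_eq[OF M(2)] mult.commute)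
    have I4: "(\<integral>p. J (fst p) (snd p) \<partial>(M \<Otimes>\<^sub>M N)) = m * measure N E"
      using MN.integral_snd[of J] int3
      by (simp add: Jx sets_eq_imp_space_eq[OF N(2)] case_prod_beta' mult.commute)
    have "\<bar>k * (\<integral>x. F x \<partial>M) - m * (\<integral>x. F x \<partial>N)\<bar>
        = \<bar>\<integral>p. J (fst p) (snd p) * F (fst p) - J (fst p) (snd p) * F (snd p) \<partial>(M \<Otimes>\<^sub>M N)\<bar>"
      using int1 int2 by (simp add: I1 I2)
    also have "\<dots> \<le> (\<integral>p. \<bar>J (fst p) (snd p) * F (fst p) - J (fst p) (snd p) * F (snd p)\<bar> \<partial>(M \<Otimes>\<^sub>M N))"
      by (rule integral_abs_bound)
    also have "\<dots> \<le> (\<integral>p. \<epsilon> * J (fst p) (snd p) \<partial>(M \<Otimes>\<^sub>M N))"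
    proof (rule integral_mono)
      fix p :: "'a \<times> 'a"
      obtain x y where p: "p = (x, y)" by (cases p)
      show "\<bar>J (fst p) (snd p) * F (fst p) - J (fst p) (snd p) * F (snd p)\<bar> \<le> \<epsilon> * J (fst p) (snd p)"
        using d(2)[of x y] by (auto simp: p J_def F_def indicator_def)
    qed (use int1 int2 int3 in auto)
    also have "\<dots> = \<epsilon> * (k * measure M E)" by (simp add: I3)
    finally have *: "\<bar>k * (\<integral>x. F x \<partial>M) - m * (\<integral>x. F x \<partial>N)\<bar> \<le> \<epsilon> * (k * measure M E)" .
    have "k * \<bar>measure N E * (\<integral>x. F x \<partial>M) - measure M E * (\<integral>x. F x \<partial>N)\<bar>
        = \<bar>measure N E * (k * (\<integral>x. F x \<partial>M)) - (k * measure M E) * (\<integral>x. F x \<partial>N)\<bar>"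
      using kpos by (subst abs_of_pos[OF kpos, symmetric], subst abs_mult[symmetric]) (simp add: algebra_simps)
    also have "\<dots> = measure N E * \<bar>k * (\<integral>x. F x \<partial>M) - m * (\<integral>x. F x \<partial>N)\<bar>"
      unfolding I3[symmetric] I4
      by (subst abs_of_pos[OF NE, symmetric], subst abs_mult[symmetric]) (simp add: algebra_simps)
    also have "\<dots> \<le> measure N E * (\<epsilon> * (k * measure M E))"
      using * NE by (intro mult_left_mono) auto
    also have "\<dots> = k * (\<epsilon> * (measure M E * measure N E))" by simp
    finally show ?thesis using kpos by simp
  qed
  define X where "X = \<bar>measure N E * (\<integral>x. F x \<partial>M) - measure M E * (\<integral>x. F x \<partial>N)\<bar>"
  define Y where "Y = measure M E * measure N E"
  have Y: "0 \<le> Y" by (simp add: Y_def)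
  have "X \<le> 0 + \<eta>" if "\<eta> > 0" for \<eta>
  proof -
    \<comment> \<open>The summand 1 keeps the denominator positive when
      \<open>Y = 0\<close>.\<close>
    have "X \<le> \<eta> / (Y + 1) * Y" unfolding X_def Y_def
      by (rule bound) (use that Y in \<open>auto simp: Y_def intro!: divide_pos_pos add_nonneg_pos\<close>)
    also have "\<dots> \<le> \<eta>" using that Y by (simp add: divide_le_eq algebra_simps)
    finally show ?thesis by simp
  qed
  then have "X \<le> 0" by (rule field_le_epsilon)
  then show ?thesis by (simp add: X_def F_def)
qed

section \<open>A model of the measure on an equator built from Lebesgue measure\<close>

definition tent :: "real \<Rightarrow> real" where
  "tent t = max 0 (1 - \<bar>t\<bar>)"

lemma tent_nonneg [simp]: "0 \<le> tent t" and tent_minus [simp]: "tent (- t) = tent t"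
  and tent_eq_0: "1 \<le> \<bar>t\<bar> \<Longrightarrow> tent t = 0" and tent_0 [simp]: "tent 0 = 1"
  by (auto simp: tent_def)

lemma continuous_on_tent [continuous_intros]:
  "continuous_on S f \<Longrightarrow> continuous_on S (\<lambda>x. tent (f x))"
  unfolding tent_def by (intro continuous_intros)

lemma measurable_tent [measurable]: "tent \<in> borel_measurable borel"
  by (intro borel_measurable_continuous_onI continuous_intros continuous_on_id)

lemma measurable_sgn_euclidean [measurable]:
  "(sgn :: 'a::euclidean_space \<Rightarrow> 'a) \<in> borel_measurable borel"
  unfolding sgn_div_norm[abs_def] by measurable

definition orth_part :: "'a::real_inner \<Rightarrow> 'a \<Rightarrow> 'a" where
  "orth_part u z = z - (z \<bullet> u / (u \<bullet> u)) *\<^sub>R u"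

lemma continuous_orth_part [continuous_intros]:
  "continuous_on S f \<Longrightarrow> continuous_on S (\<lambda>x. orth_part u (f x))"
  unfolding orth_part_def divide_inverse by (intro continuous_intros)

lemma measurable_orth_part [measurable]:
  "(orth_part u :: 'a::euclidean_space \<Rightarrow> 'a) \<in> borel_measurable borel"
  by (intro borel_measurable_continuous_onI continuous_intros continuous_on_id)

lemma inner_orth_part: "orth_part u z \<bullet> u = 0"
  by (cases "u = 0") (auto simp: orth_part_def inner_diff_left)

lemma orth_part_reflection:
  "orth_part (hyperplane_reflection d u) (hyperplane_reflection d z) = hyperplane_reflection d (orth_part u z)"
  by (simp add: orth_part_def inner_hyperplane_reflection hyperplane_reflection_diff hyperplane_reflection_scale)

lemma sgn_reflection: "sgn (hyperplane_reflection d z) = hyperplane_reflection d (sgn z)"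
  by (simp add: sgn_div_norm hyperplane_reflection_scale)

text \<open>The radial factors are those that \<open>(x \<bullet> v) * (x \<bullet> w)\<close> and the continuous
  cut-off density \<open>radial_profile g\<close> contribute on the hyperplane orthogonal to \<open>u\<close>.\<close>

definition slab_weight :: "'a::real_inner \<Rightarrow> 'a \<Rightarrow> real" where
  "slab_weight u z = tent (z \<bullet> u) * (norm (orth_part u z) ^ 3 * tent (norm (orth_part u z)))"

lemma slab_weight_nonneg [simp]: "0 \<le> slab_weight u z"
  by (simp add: slab_weight_def)

lemma slab_weight_reflection:
  "slab_weight (hyperplane_reflection d u) (hyperplane_reflection d z) = slab_weight u z"
  by (simp add: slab_weight_def orth_part_reflection inner_hyperplane_reflection)

lemma continuous_slab_weight [continuous_intros]:
  "continuous_on S f \<Longrightarrow> continuous_on S (\<lambda>x. slab_weight u (f x))"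
  unfolding slab_weight_def by (intro continuous_intros)

lemma measurable_slab_weight [measurable]:
  "(slab_weight u :: 'a::euclidean_space \<Rightarrow> real) \<in> borel_measurable borel"
  by (intro borel_measurable_continuous_onI continuous_intros continuous_on_id)

lemma integrable_continuous_bounded_support:
  fixes f :: "'a::euclidean_space \<Rightarrow> real"
  assumes f: "continuous_on UNIV f" and 0: "\<And>x. norm x > r \<Longrightarrow> f x = 0"
  shows "integrable lborel f"
proof -
  have "integrable lborel (\<lambda>x. indicator (cball 0 r) x *\<^sub>R f x)"
    using f by (intro borel_integrable_compact continuous_on_subset[OF f]) auto
  moreover have "(\<lambda>x. indicator (cball 0 r) x *\<^sub>R f x) = f"
    using 0 by (auto simp: indicator_def fun_eq_iff not_le)
  ultimately show ?thesis by simp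
qed

text \<open>On the support, the component of \<open>z\<close> along \<open>u\<close> is shorter than
  \<open>1 / norm u\<close> and the orthogonal one shorter than 1.\<close>

lemma slab_weight_eq_0:
  assumes u: "u \<noteq> 0" and z: "norm z > 1 + 1 / norm u"
  shows "slab_weight u z = 0"
proof (rule ccontr)
  assume "slab_weight u z \<noteq> 0"
  then have "tent (z \<bullet> u) \<noteq> 0" "tent (norm (orth_part u z)) \<noteq> 0" by (auto simp: slab_weight_def)
  then have *: "\<bar>z \<bullet> u\<bar> < 1" "norm (orth_part u z) < 1"
    using tent_eq_0[of "z \<bullet> u"] tent_eq_0[of "norm (orth_part u z)"] by fastforce+
  have "norm z = norm (orth_part u z + (z \<bullet> u / (u \<bullet> u)) *\<^sub>R u)"
    by (simp add: orth_part_def)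
  also have "\<dots> \<le> norm (orth_part u z) + norm ((z \<bullet> u / (u \<bullet> u)) *\<^sub>R u)"
    by (rule norm_triangle_ineq)
  also have "norm ((z \<bullet> u / (u \<bullet> u)) *\<^sub>R u) = \<bar>z \<bullet> u\<bar> / norm u"
    using u by (simp add: dot_square_norm power2_eq_square)
  also have "\<bar>z \<bullet> u\<bar> / norm u \<le> 1 / norm u"
    using * u by (intro divide_right_mono) auto
  finally show False using * z by linarith
qed

lemma integrable_slab_weight:
  fixes u :: "'a::euclidean_space"
  assumes "u \<noteq> 0"
  shows "integrable lborel (slab_weight u)"
  using slab_weight_eq_0[OF assms]
  by (intro integrable_continuous_bounded_support) (auto intro!: continuous_intros)

text \<open>A weighted slab around the hyperplane orthogonal to \<open>u\<close> is projected
  radially to the equator. On the line spanned by \<open>u\<close>, where \<open>sgn\<close> yields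
  0 and so misses the equator, the weight is 0. The total mass depends on the norm of
  \<open>u\<close>, which sets the thickness of the slab.\<close>

definition equator_image_measure :: "'a::euclidean_space \<Rightarrow> 'a measure" where
  "equator_image_measure u =
     distr (density lborel (\<lambda>z. ennreal (slab_weight u z))) borel (\<lambda>z. sgn (orth_part u z))"

lemma sets_equator_image_measure [simp, measurable_cong]: "sets (equator_image_measure u) = sets borel"
  by (simp add: equator_image_measure_def)

lemma emeasure_equator_image_measure:
  assumes [measurable]: "A \<in> sets borel"
  shows "emeasure (equator_image_measure u) A
    = (\<integral>\<^sup>+z. ennreal (slab_weight u z) * indicator A (sgn (orth_part u z)) \<partial>lborel)"
proof -
  have "emeasure (equator_image_measure u) A = (\<integral>\<^sup>+x. indicator A x \<partial>equator_image_measure u)"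
    by simp
  also have "\<dots> = (\<integral>\<^sup>+z. indicator A (sgn (orth_part u z)) \<partial>density lborel (\<lambda>z. ennreal (slab_weight u z)))"
    unfolding equator_image_measure_def by (rule nn_integral_distr) auto
  finally show ?thesis by (simp add: nn_integral_density)
qed

text \<open>Reflections preserve \<open>lborel\<close> and commute with every ingredient: slab
  weight, orthogonal part and \<open>sgn\<close>.\<close>

lemma emeasure_equator_image_measure_reflection:
  assumes A: "A \<in> sets borel"
  shows "emeasure (equator_image_measure (hyperplane_reflection d u)) A
    = emeasure (equator_image_measure u) (hyperplane_reflection d -` A)"
proof -
  let ?R = "hyperplane_reflection d"
  note [measurable] = A
  have [measurable]: "?R -` A \<in> sets borel"
    using measurable_sets_borel[OF measurable_hyperplane_reflection A] by simp
  have "emeasure (equator_image_measure (?R u)) A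
    = (\<integral>\<^sup>+z. ennreal (slab_weight (?R u) z) * indicator A (sgn (orth_part (?R u) z)) \<partial>distr lborel borel ?R)"
    by (simp add: emeasure_equator_image_measure lborel_distr_hyperplane_reflection)
  also have "\<dots> = (\<integral>\<^sup>+z. ennreal (slab_weight (?R u) (?R z)) * indicator A (sgn (orth_part (?R u) (?R z))) \<partial>lborel)"
    by (rule nn_integral_distr) auto
  also have "\<dots> = (\<integral>\<^sup>+z. ennreal (slab_weight u z) * indicator (?R -` A) (sgn (orth_part u z)) \<partial>lborel)"
    by (simp add: slab_weight_reflection orth_part_reflection sgn_reflection indicator_def)
  finally show ?thesis by (simp add: emeasure_equator_image_measure)
qed

lemma finite_equator_image_measure:
  assumes "u \<noteq> 0"
  shows "finite_measure (equator_image_measure u)"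
proof (rule finite_measureI)
  have "space (equator_image_measure u) = UNIV"
    by (simp add: equator_image_measure_def)
  then show "emeasure (equator_image_measure u) (space (equator_image_measure u)) \<noteq> \<infinity>"
    using integrable_slab_weight[OF assms]
    by (simp add: emeasure_equator_image_measure integrable_iff_bounded)
qed

section \<open>Comparison of the two measures on an equator\<close>

lemma closed_equator: "closed (equator u)"
proof -
  have "closed {x. x \<bullet> u = 0}"
    by (intro closed_Collect_eq continuous_intros)
  then show ?thesis unfolding equator_def by (intro closed_Int) auto
qed

lemma compact_equator: "compact (equator u)"
  using closed_equator bounded_subset[OF bounded_sphere] unfolding compact_eq_bounded_closed
  by (metis Int_lower1 equator_def)

lemma borel_equator [measurable]: "equator u \<in> sets borel"
  using closed_equator by (rule borel_closed)

definition equator_measure :: "real ^ 'n \<Rightarrow> (real ^ 'n) measure" where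
  "equator_measure u = density (hausdorff_measure (CARD('n) - 2)) (indicator (equator u))"

lemma sets_equator_measure [simp, measurable_cong]: "sets (equator_measure u) = sets borel"
  by (simp add: equator_measure_def sets_hausdorff_measure)

lemma emeasure_equator_measure:
  assumes A: "A \<in> sets borel"
  shows "emeasure (equator_measure u :: (real ^ 'n) measure) A = hausdorff_outer (CARD('n) - 2) (A \<inter> equator u)"
proof -
  note [measurable_cong] = sets_hausdorff_measure[where 'a = "real ^ 'n"]
  have "emeasure (equator_measure u) A = emeasure (hausdorff_measure (CARD('n) - 2)) (equator u \<inter> A)"
    unfolding equator_measure_def using A
    by (subst emeasure_density) (auto simp: sets_hausdorff_measure simp flip: indicator_inter_arith)
  then show ?thesis using A by (simp add: emeasure_hausdorff_measure Int_commute)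
qed

lemma integral_equator_measure:
  fixes f :: "real ^ 'n \<Rightarrow> real"
  assumes f: "(\<lambda>x. indicator (equator u) x * f x) \<in> borel_measurable borel"
  shows "(\<integral>x. indicator (equator u) x * f x \<partial>equator_measure u)
    = (LINT x:equator u|hausdorff_measure (CARD('n) - 2). f x)"
proof -
  note [measurable_cong] = sets_hausdorff_measure[where 'a = "real ^ 'n"]
  note [measurable] = f
  have "equator_measure u = density (hausdorff_measure (CARD('n) - 2)) (\<lambda>x. ennreal (indicator (equator u) x))"
    unfolding equator_measure_def by (intro density_cong) (auto simp: indicator_def)
  then show ?thesis
    unfolding set_lebesgue_integral_def
    using f by (simp add: integral_real_density measurable_cong_sets[OF sets_hausdorff_measure refl])
       (auto intro!: Bochner_Integration.integral_cong simp: indicator_def)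
qed

lemma finite_equator_measure:
  fixes u :: "real ^ 'n"
  assumes "u \<noteq> 0" "CARD('n) \<ge> 3"
  shows "finite_measure (equator_measure u)"
proof (rule finite_measureI)
  have "space (equator_measure u) = UNIV"
    by (simp add: equator_measure_def space_hausdorff_measure)
  then show "emeasure (equator_measure u) (space (equator_measure u)) \<noteq> \<infinity>"
    using hausdorff_outer_equator_finite[OF assms] by (simp add: emeasure_equator_measure)
qed

text \<open>The reflection exchanging two points of the equator fixes \<open>u\<close>, because
  their difference is orthogonal to \<open>u\<close>; hence it preserves the equator.\<close>

lemma reflection_vimage_ball_equator:
  assumes x: "x \<in> equator u" and y: "y \<in> equator u"
  shows "hyperplane_reflection (x - y) u = u"
    and "hyperplane_reflection (x - y) -` (ball y r \<inter> equator u) = ball x r \<inter> equator u"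
    and "hyperplane_reflection (x - y) ` (ball x r \<inter> equator u) = ball y r \<inter> equator u"
proof -
  let ?R = "hyperplane_reflection (x - y)"
  have "u \<bullet> (x - y) = 0" using x y by (simp add: equator_def inner_diff_right inner_commute)
  then show Ru: "?R u = u" by (rule hyperplane_reflection_orth)
  have "norm x = norm y" using x y by (simp add: equator_def)
  then have Rx: "?R x = y" by (rule hyperplane_reflection_swap)
  have "?R z \<bullet> u = z \<bullet> u" for z
    using inner_hyperplane_reflection[of "x - y" z u] by (simp add: Ru)
  moreover have "dist y (?R z) = dist x z" for z
    using dist_hyperplane_reflection[of "x - y" x z] by (simp add: Rx)
  ultimately show v: "?R -` (ball y r \<inter> equator u) = ball x r \<inter> equator u"
    by (auto simp: equator_def)
  show "?R ` (ball x r \<inter> equator u) = ball y r \<inter> equator u"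
    unfolding v[symmetric] by (intro surj_image_vimage_eq) (metis hyperplane_reflection_involution surjI)
qed

text \<open>Reflections show that under both measures the balls centred on the equator have masses
  independent of the centre. The masses are multiplied across, so no division by the Hausdorff mass
  occurs.\<close>

lemma equator_integral_proportional:
  fixes u :: "real ^ 'n" and f :: "real ^ 'n \<Rightarrow> real"
  assumes u: "u \<noteq> 0" and card: "CARD('n) \<ge> 3" and f: "continuous_on (equator u) f"
  shows "measure (equator_image_measure u) (equator u) * (LINT x:equator u|hausdorff_measure (CARD('n) - 2). f x)
    = measure (equator_measure u) (equator u) * (\<integral>z. slab_weight u z * f (sgn (orth_part u z)) \<partial>lborel)"
proof -
  have meas [measurable]: "(\<lambda>x. indicator (equator u) x * f x) \<in> borel_measurable borel"
    using borel_measurable_continuous_on_indicator[OF borel_equator f] by simp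
  have "measure (equator_image_measure u) (equator u) * (\<integral>x. indicator (equator u) x * f x \<partial>equator_measure u)
    = measure (equator_measure u) (equator u) * (\<integral>x. indicator (equator u) x * f x \<partial>equator_image_measure u)"
  proof (rule uniformly_distributed_proportional)
    fix x y r assume xy: "x \<in> equator u" "y \<in> equator u"
    note R = reflection_vimage_ball_equator[OF xy]
    have [measurable]: "ball z r \<inter> equator u \<in> sets borel" for z by measurable
    have "hausdorff_outer (CARD('n) - 2) (ball y r \<inter> equator u) = hausdorff_outer (CARD('n) - 2) (ball x r \<inter> equator u)"
      unfolding R(3)[of r, symmetric] by (rule hausdorff_outer_reflection)
    then show "measure (equator_measure u) (ball x r \<inter> equator u) = measure (equator_measure u) (ball y r \<inter> equator u)"
      by (simp add: measure_def emeasure_equator_measure Int_assoc)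
    show "measure (equator_image_measure u) (ball x r \<inter> equator u)
        = measure (equator_image_measure u) (ball y r \<inter> equator u)"
      using emeasure_equator_image_measure_reflection[of "ball y r \<inter> equator u" "x - y" u]
      by (simp only: measure_def R(1) R(2)[of r]) simp
  qed (use assms in \<open>auto intro: compact_equator finite_equator_measure finite_equator_image_measure\<close>)
  also have "(\<integral>x. indicator (equator u) x * f x \<partial>equator_image_measure u)
     = (\<integral>z. slab_weight u z * (indicator (equator u) (sgn (orth_part u z)) * f (sgn (orth_part u z))) \<partial>lborel)"
    unfolding equator_image_measure_def
    by (subst integral_distr, simp, simp, subst integral_real_density) auto
  also have "\<dots> = (\<integral>z. slab_weight u z * f (sgn (orth_part u z)) \<partial>lborel)"
  proof (rule Bochner_Integration.integral_cong)
    fix z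
    have "sgn (orth_part u z) \<in> equator u" if "orth_part u z \<noteq> 0"
      using that by (simp add: equator_def norm_sgn) (simp add: sgn_div_norm inner_orth_part)
    then show "slab_weight u z * (indicator (equator u) (sgn (orth_part u z)) * f (sgn (orth_part u z)))
      = slab_weight u z * f (sgn (orth_part u z))"
      by (cases "orth_part u z = 0") (auto simp: slab_weight_def)
  qed simp
  finally show ?thesis by (simp add: integral_equator_measure)
qed

text \<open>The reflection along \<open>a - b\<close> carries one equator to the other.\<close>

lemma equator_mass_cong:
  fixes a b :: "real ^ 'n"
  assumes ab: "norm a = norm b"
  shows "measure (equator_measure a) (equator a) = measure (equator_measure b) (equator b)"
    and "measure (equator_image_measure a) (equator a) = measure (equator_image_measure b) (equator b)"
proof -
  let ?R = "hyperplane_reflection (a - b)"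
  have "hausdorff_outer (CARD('n) - 2) (equator b) = hausdorff_outer (CARD('n) - 2) (equator a)"
    unfolding equator_reflection[OF ab, symmetric] by (rule hausdorff_outer_reflection)
  then show "measure (equator_measure a) (equator a) = measure (equator_measure b) (equator b)"
    by (simp add: measure_def emeasure_equator_measure)
  have "?R -` equator b = equator a"
    unfolding equator_reflection[OF ab, symmetric]
    by (intro inj_vimage_image_eq injI) (metis hyperplane_reflection_involution)
  then show "measure (equator_image_measure a) (equator a) = measure (equator_image_measure b) (equator b)"
    using emeasure_equator_image_measure_reflection[of "equator b" "a - b" a]
    by (simp add: measure_def hyperplane_reflection_swap[OF ab])
qed

lemma equator_nonempty:
  fixes u :: "real ^ 'n"
  assumes card: "CARD('n) \<ge> 2"
  obtains y where "y \<in> equator u"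
proof -
  have "dim {u} \<le> 1" using dim_le_card'[of "{u}"] by simp
  then have "dim (span {u}) < DIM(real ^ 'n)" using card by simp
  then obtain y where "y \<noteq> 0" "\<And>x. x \<in> span (span {u}) \<Longrightarrow> orthogonal y x"
    using orthogonal_to_subspace_exists[of "span {u}"] by auto
  then have "y \<noteq> 0" "y \<bullet> u = 0" by (auto simp: orthogonal_def span_base)
  then have "sgn y \<in> equator u" by (simp add: equator_def norm_sgn) (simp add: sgn_div_norm)
  then show ?thesis by (rule that)
qed

lemma equator_image_mass_pos:
  fixes u :: "real ^ 'n"
  assumes u: "u \<noteq> 0" and card: "CARD('n) \<ge> 2"
  shows "measure (equator_image_measure u) (equator u) > 0"
proof (rule ccontr)
  assume "\<not> ?thesis"
  then have "measure (equator_image_measure u) (equator u) = 0" by (simp add: zero_less_measure_iff)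
  then have "emeasure (equator_image_measure u) (equator u) = 0"
    using finite_measure.emeasure_eq_measure[OF finite_equator_image_measure[OF u]] by simp
  then have "AE z in lborel. slab_weight u z * indicator (equator u) (sgn (orth_part u z)) = 0"
    by (simp add: emeasure_equator_image_measure nn_integral_0_iff_AE) 
       (auto elim!: eventually_mono simp: indicator_def split: if_splits intro: order_antisym)
  then have AE: "AE z in lborel. slab_weight u z = 0"
  proof (rule eventually_mono)
    fix z assume *: "slab_weight u z * indicator (equator u) (sgn (orth_part u z)) = 0"
    show "slab_weight u z = 0"
    proof (cases "orth_part u z = 0")
      case False
      then have "sgn (orth_part u z) \<in> equator u"
        by (simp add: equator_def norm_sgn) (simp add: sgn_div_norm inner_orth_part)
      then show ?thesis using * by simp
    qed (simp add: slab_weight_def)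
  qed
  obtain y where y: "y \<in> equator u" using card by (rule equator_nonempty)
  have op: "open {z. slab_weight u z \<noteq> 0}"
    by (intro open_Collect_neq continuous_intros)
  have "AE z in lborel. z \<notin> {z. slab_weight u z \<noteq> 0}" using AE by simp
  then have "{z. slab_weight u z \<noteq> 0} \<in> null_sets lborel"
    using op by (subst AE_iff_null_sets) auto
  then have "negligible {z. slab_weight u z \<noteq> 0}"
    by (metis negligible_iff_null_sets null_sets_completionI)
  then have "{z. slab_weight u z \<noteq> 0} = {}"
    using open_not_negligible[OF op] by blast
  \<comment> \<open>Half an equator point is orthogonal to \<open>u\<close> and has norm 1/2,
    strictly between the zeros 0 and 1 of the radial factor.\<close>
  moreover have "slab_weight u (y /\<^sub>R 2) \<noteq> 0"
    using y by (simp add: slab_weight_def orth_part_def equator_def tent_def)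
  ultimately show False by blast
qed

text \<open>The two substitutions are the oblique reflections along \<open>e\<close> and \<open>u /\<^sub>R (u \<bullet> u) + e\<close>.\<close>

lemma integral_oblique_projection:
  fixes e u :: "'a::euclidean_space" and \<psi> :: "'a \<Rightarrow> real"
  assumes \<psi> [measurable]: "\<psi> \<in> borel_measurable borel" and e: "e \<bullet> e = 1" "e \<bullet> u = 1"
  shows "(\<integral>x. tent (x \<bullet> e) * \<psi> (x - (x \<bullet> u) *\<^sub>R e) \<partial>lborel) = (\<integral>x. tent (x \<bullet> u) * \<psi> (orth_part u x) \<partial>lborel)"
proof -
  have cov: "(\<integral>x. f (x - (x \<bullet> y) *\<^sub>R b) \<partial>lborel) = (\<integral>x. f x \<partial>lborel)"
    if "f \<in> borel_measurable borel" "b \<bullet> y = 2" for f :: "'a \<Rightarrow> real" and b y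
    using integral_distr[of "\<lambda>x. x - (x \<bullet> y) *\<^sub>R b" lborel borel f] that
    by (simp add: lborel_distr_oblique_reflection)
  have u: "u \<bullet> u \<noteq> 0" using e by auto
  \<comment> \<open>The first reflection preserves the projection along \<open>e\<close> and turns
    \<open>x \<bullet> e\<close> into \<open>- (x \<bullet> u)\<close>.\<close>
  have "(\<integral>x. tent (x \<bullet> e) * \<psi> (x - (x \<bullet> u) *\<^sub>R e) \<partial>lborel)
      = (\<integral>x. tent ((x - (x \<bullet> (e + u)) *\<^sub>R e) \<bullet> e)
        * \<psi> ((x - (x \<bullet> (e + u)) *\<^sub>R e) - ((x - (x \<bullet> (e + u)) *\<^sub>R e) \<bullet> u) *\<^sub>R e) \<partial>lborel)"
    using e by (intro cov[symmetric]) (auto simp: inner_add_right)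
  also have "\<dots> = (\<integral>x. tent (x \<bullet> u) * \<psi> (x - (x \<bullet> u) *\<^sub>R e) \<partial>lborel)"
  proof (rule Bochner_Integration.integral_cong)
    fix x
    have "tent ((x - (x \<bullet> (e + u)) *\<^sub>R e) \<bullet> e) = tent (x \<bullet> u)"
      using tent_minus[of "x \<bullet> u"] by (simp add: inner_diff_left inner_add_right e)
    moreover have "(x - (x \<bullet> (e + u)) *\<^sub>R e) \<bullet> u = - (x \<bullet> e)"
      by (simp add: inner_diff_left inner_add_right e)
    then have "(x - (x \<bullet> (e + u)) *\<^sub>R e) - ((x - (x \<bullet> (e + u)) *\<^sub>R e) \<bullet> u) *\<^sub>R e = x - (x \<bullet> u) *\<^sub>R e"
      by (simp only: inner_add_right scaleR_add_left scaleR_minus_left) simp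
    ultimately show "tent ((x - (x \<bullet> (e + u)) *\<^sub>R e) \<bullet> e)
        * \<psi> ((x - (x \<bullet> (e + u)) *\<^sub>R e) - ((x - (x \<bullet> (e + u)) *\<^sub>R e) \<bullet> u) *\<^sub>R e)
        = tent (x \<bullet> u) * \<psi> (x - (x \<bullet> u) *\<^sub>R e)" by (simp only:)
  qed simp
  \<comment> \<open>The second reflection changes the sign of \<open>x \<bullet> u\<close> and turns
    the projection along \<open>e\<close> into the orthogonal one.\<close>
  also have "\<dots> = (\<integral>x. tent ((x - (x \<bullet> u) *\<^sub>R (u /\<^sub>R (u \<bullet> u) + e)) \<bullet> u)
        * \<psi> ((x - (x \<bullet> u) *\<^sub>R (u /\<^sub>R (u \<bullet> u) + e)) - ((x - (x \<bullet> u) *\<^sub>R (u /\<^sub>R (u \<bullet> u) + e)) \<bullet> u) *\<^sub>R e) \<partial>lborel)"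
    using e u by (intro cov[symmetric]) (auto simp: inner_add_left)
  also have "\<dots> = (\<integral>x. tent (x \<bullet> u) * \<psi> (orth_part u x) \<partial>lborel)"
  proof (rule Bochner_Integration.integral_cong)
    fix x
    have i: "(x - (x \<bullet> u) *\<^sub>R (u /\<^sub>R (u \<bullet> u) + e)) \<bullet> u = - (x \<bullet> u)"
      using e u by (simp add: inner_diff_left inner_add_left)
    have "(x - (x \<bullet> u) *\<^sub>R (u /\<^sub>R (u \<bullet> u) + e)) - (- (x \<bullet> u)) *\<^sub>R e = orth_part u x"
      by (simp add: orth_part_def scaleR_add_right divide_inverse)
    then show "tent ((x - (x \<bullet> u) *\<^sub>R (u /\<^sub>R (u \<bullet> u) + e)) \<bullet> u)
        * \<psi> ((x - (x \<bullet> u) *\<^sub>R (u /\<^sub>R (u \<bullet> u) + e)) - ((x - (x \<bullet> u) *\<^sub>R (u /\<^sub>R (u \<bullet> u) + e)) \<bullet> u) *\<^sub>R e)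
      = tent (x \<bullet> u) * \<psi> (orth_part u x)"
      unfolding i by (simp only: tent_minus)
  qed simp
  finally show ?thesis .
qed

section \<open>The potential of an equator integral\<close>

text \<open>This is the fundamental theorem of calculus for the integral of \<open>h\<close> from 0
  to \<tau>, rescaled to the unit interval.\<close>

lemma has_real_derivative_segment_integral:
  fixes h :: "real \<Rightarrow> real"
  assumes h: "continuous_on UNIV h"
  shows "((\<lambda>\<tau>. \<tau> * integral {0..1} (\<lambda>r. h (r * \<tau>))) has_real_derivative h \<tau>0) (at \<tau>0)"
proof -
  define R where "R = \<bar>\<tau>0\<bar> + 1"
  have "continuous_on {-R..R} h" using h by (rule continuous_on_subset) simp
  then obtain A where A: "\<And>x. x \<in> {-R..R} \<Longrightarrow> (A has_vector_derivative h x) (at x within {-R..R})"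
    using antiderivative_continuous by metis
  have eq: "\<tau> * integral {0..1} (\<lambda>r. h (r * \<tau>)) = A \<tau> - A 0" if \<tau>: "\<tau> \<in> {-R<..<R}" for \<tau>
  proof -
    have "((\<lambda>r. \<tau> * h (r * \<tau>)) has_integral A (1 * \<tau>) - A (0 * \<tau>)) {0..1}"
    proof (rule fundamental_theorem_of_calculus)
      fix r :: real assume r: "r \<in> {0..1}"
      have "\<bar>r * \<tau>\<bar> \<le> 1 * \<bar>\<tau>\<bar>" unfolding abs_mult using r by (intro mult_right_mono) auto
      then have rt: "r * \<tau> \<in> {-R<..<R}" using \<tau> by (auto simp: abs_le_iff abs_less_iff)
      then have "(A has_vector_derivative h (r * \<tau>)) (at (r * \<tau>))"
        using A[of "r * \<tau>"] by (simp add: at_within_Icc_at)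
      then have "(A has_real_derivative h (r * \<tau>)) (at (r * \<tau>))"
        by (simp add: has_real_derivative_iff_has_vector_derivative)
      moreover have "((\<lambda>r. r * \<tau>) has_real_derivative \<tau>) (at r within {0..1})"
        by (auto intro!: derivative_eq_intros)
      ultimately have "((\<lambda>r. A (r * \<tau>)) has_real_derivative h (r * \<tau>) * \<tau>) (at r within {0..1})"
        by (rule DERIV_chain2)
      then show "((\<lambda>r. A (r * \<tau>)) has_vector_derivative \<tau> * h (r * \<tau>)) (at r within {0..1})"
        by (simp add: has_real_derivative_iff_has_vector_derivative mult.commute)
    qed simp
    then have "integral {0..1} (\<lambda>r. \<tau> * h (r * \<tau>)) = A (1 * \<tau>) - A (0 * \<tau>)"
      by (rule integral_unique)
    then show ?thesis unfolding integral_mult_right by (simp only: mult_1 mult_zero_left)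
  qed
  have \<tau>0: "\<tau>0 \<in> {-R<..<R}" by (auto simp: R_def)
  then have "(A has_real_derivative h \<tau>0) (at \<tau>0)"
    using A[of \<tau>0] by (simp add: has_real_derivative_iff_has_vector_derivative at_within_Icc_at)
  then have "((\<lambda>\<tau>. A \<tau> - A 0) has_real_derivative h \<tau>0) (at \<tau>0)"
    by (auto intro!: derivative_eq_intros)
  then show ?thesis
    by (rule has_field_derivative_transform_within_open[of _ _ _ "{-R<..<R}"]) (use eq \<tau>0 in auto)
qed

text \<open>On the affine hyperplane \<open>u \<bullet> e = 1\<close> this is, up to a constant, half the integral of
  \<open>\<psi>\<close> against \<open>sgn (x \<bullet> u)\<close>, sliced along \<open>e\<close>. The inner integral is the one of
  \<open>\<psi> (x - s *\<^sub>R e)\<close> over \<open>s\<close> from \<open>0\<close> to \<open>x \<bullet> u\<close>, rescaled so that it is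
  correctly signed for negative \<open>x \<bullet> u\<close>.\<close>

definition half_space_potential :: "'a::euclidean_space \<Rightarrow> ('a \<Rightarrow> real) \<Rightarrow> 'a \<Rightarrow> real" where
  "half_space_potential e \<psi> u = integral (cbox (-2 *\<^sub>R One) (2 *\<^sub>R One))
     (\<lambda>x. tent (x \<bullet> e) * (x \<bullet> u * integral {0..1} (\<lambda>r. \<psi> (x - (r * (x \<bullet> u)) *\<^sub>R e))))"

text \<open>The inner integral depends on \<open>t\<close> only through its end point
  \<open>x \<bullet> \<gamma> t\<close>. When \<open>e \<bullet> \<gamma> t0 = 1\<close>, the point
  at which \<psi> is evaluated is the projection of \<open>x\<close> along \<open>e\<close> to the
  hyperplane orthogonal to \<open>\<gamma> t0\<close>.\<close>

lemma half_space_potential_derivative: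
  fixes e :: "'a::euclidean_space" and \<gamma> \<gamma>' :: "real \<Rightarrow> 'a"
  assumes \<psi>: "continuous_on UNIV \<psi>" and \<psi>0: "\<And>y. norm y > 1 \<Longrightarrow> \<psi> y = 0" and e: "e \<bullet> e = 1"
    and \<gamma>: "\<And>t. (\<gamma> has_vector_derivative \<gamma>' t) (at t)" and \<gamma>': "continuous_on UNIV \<gamma>'"
  shows "((\<lambda>t. half_space_potential e \<psi> (\<gamma> t)) has_real_derivative
    (\<integral>x. tent (x \<bullet> e) * (x \<bullet> \<gamma>' t0 * \<psi> (x - (x \<bullet> \<gamma> t0) *\<^sub>R e)) \<partial>lborel)) (at t0)"
proof -
  let ?B = "cbox (-2 *\<^sub>R One) (2 *\<^sub>R One) :: 'a set"
  define f where "f = (\<lambda>t x. tent (x \<bullet> e) * (x \<bullet> \<gamma> t * integral {0..1} (\<lambda>r. \<psi> (x - (r * (x \<bullet> \<gamma> t)) *\<^sub>R e))))"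
  define f' where "f' = (\<lambda>t x. tent (x \<bullet> e) * (x \<bullet> \<gamma>' t * \<psi> (x - (x \<bullet> \<gamma> t) *\<^sub>R e)))"
  have \<gamma>c: "continuous_on UNIV \<gamma>"
    using \<gamma> by (auto simp: continuous_on_eq_continuous_within intro!: has_vector_derivative_continuous)
  have \<psi>c: "continuous_on S (\<lambda>z. \<psi> (k z))" if "continuous_on S k" for S :: "'c::topological_space set" and k
    using that by (rule continuous_on_compose2[OF \<psi>]) auto
  have \<gamma>c2: "continuous_on S (\<lambda>z. \<gamma> (k z))" "continuous_on S (\<lambda>z. \<gamma>' (k z))" if "continuous_on S k"
    for S :: "('c::topological_space) set" and k
    using that by (auto intro: continuous_on_compose2[OF \<gamma>c] continuous_on_compose2[OF \<gamma>'])
  have "((\<lambda>t. integral ?B (f t)) has_vector_derivative integral ?B (f' t0)) (at t0 within UNIV)"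
  proof (rule leibniz_rule_vector_derivative)
    fix t :: real and x :: 'a
    have "continuous_on UNIV (\<lambda>s. \<psi> (x - s *\<^sub>R e))" by (intro \<psi>c continuous_intros)
    from has_real_derivative_segment_integral[OF this]
    have 1: "((\<lambda>\<tau>. \<tau> * integral {0..1} (\<lambda>r. \<psi> (x - (r * \<tau>) *\<^sub>R e))) has_real_derivative
        \<psi> (x - (x \<bullet> \<gamma> t) *\<^sub>R e)) (at (x \<bullet> \<gamma> t))" .
    have 2: "((\<lambda>t. x \<bullet> \<gamma> t) has_real_derivative x \<bullet> \<gamma>' t) (at t)"
      using bounded_linear.has_vector_derivative[OF bounded_linear_inner_right \<gamma>]
      by (simp add: has_real_derivative_iff_has_vector_derivative)
    have "((\<lambda>t. f t x) has_real_derivative f' t x) (at t)"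
      unfolding f_def f'_def using DERIV_cmult[OF DERIV_chain2[OF 1 2], of "tent (x \<bullet> e)"]
      by (simp add: mult.commute)
    then show "((\<lambda>t. f t x) has_vector_derivative f' t x) (at t within UNIV)"
      by (simp add: has_real_derivative_iff_has_vector_derivative)
  next
    fix t :: real
    have "continuous_on ?B (\<lambda>x. integral (cbox 0 1) (\<lambda>r. \<psi> (x - (r * (x \<bullet> \<gamma> t)) *\<^sub>R e)))"
      by (intro integral_continuous_on_param)
         (auto simp: case_prod_beta intro!: \<psi>c continuous_intros)
    then show "f t integrable_on ?B"
      unfolding f_def by (intro integrable_continuous continuous_intros) auto
  next
    show "continuous_on (UNIV \<times> ?B) (\<lambda>(t, x). f' t x)"
      unfolding f'_def case_prod_beta by (intro continuous_intros \<psi>c \<gamma>c2)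
  qed auto
  then have D: "((\<lambda>t. half_space_potential e \<psi> (\<gamma> t)) has_real_derivative integral ?B (f' t0)) (at t0)"
    by (simp add: half_space_potential_def f_def has_real_derivative_iff_has_vector_derivative)
  have supp: "f' t0 x = 0" if x: "norm x > 2" for x
  proof (rule ccontr)
    assume "f' t0 x \<noteq> 0"
    then have *: "\<bar>x \<bullet> e\<bar> < 1" "norm (x - (x \<bullet> \<gamma> t0) *\<^sub>R e) \<le> 1"
      using tent_eq_0[of "x \<bullet> e"] \<psi>0[of "x - (x \<bullet> \<gamma> t0) *\<^sub>R e"] unfolding f'_def
      by (metis linorder_not_le mult_zero_left mult_zero_right)+
    \<comment> \<open>\<open>x\<close> and \<open>y\<close> differ by a multiple of
      \<open>e\<close>, so they have the same component orthogonal to \<open>e\<close>; the norm of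
      \<open>y\<close> bounds it.\<close>
    define y where "y = x - (x \<bullet> \<gamma> t0) *\<^sub>R e"
    have "x - (x \<bullet> e) *\<^sub>R e = y - (y \<bullet> e) *\<^sub>R e"
      by (simp add: y_def inner_diff_left e algebra_simps)
    then have "(norm (x - (x \<bullet> e) *\<^sub>R e))\<^sup>2 = y \<bullet> y - (y \<bullet> e)\<^sup>2"
      by (simp only: flip: dot_square_norm)
        (simp add: inner_diff_left inner_diff_right e inner_commute[of e y] power2_eq_square)
    also have "\<dots> \<le> 1\<^sup>2"
    proof -
      have "(norm y)\<^sup>2 \<le> 1\<^sup>2" using *(2) unfolding y_def[symmetric] by (rule power_mono) simp
      then show ?thesis using zero_le_power2[of "y \<bullet> e"] unfolding dot_square_norm by linarith
    qed
    finally have "norm (x - (x \<bullet> e) *\<^sub>R e) \<le> 1" by (rule power2_le_imp_le) simp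
    moreover have "norm x \<le> norm (x - (x \<bullet> e) *\<^sub>R e) + norm ((x \<bullet> e) *\<^sub>R e)"
      using norm_triangle_ineq[of "x - (x \<bullet> e) *\<^sub>R e" "(x \<bullet> e) *\<^sub>R e"] by simp
    moreover have "norm ((x \<bullet> e) *\<^sub>R e) \<le> 1" using * e by (simp add: norm_eq_sqrt_inner)
    ultimately show False using x by simp
  qed
  have c: "continuous_on UNIV (f' t0)"
    unfolding f'_def by (intro continuous_intros \<psi>c)
  have in_B: "x \<in> ?B" if "norm x \<le> 2" for x
    using that Basis_le_norm[of _ x] by (auto simp: mem_box abs_le_iff) (meson order_trans minus_le_iff)+
  have "f' t0 = (\<lambda>x. if x \<in> ?B then f' t0 x else 0)"
  proof
    fix x show "f' t0 x = (if x \<in> ?B then f' t0 x else 0)"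
      using supp[of x] in_B[of x] by (cases "norm x \<le> 2") auto
  qed
  then have "integral ?B (f' t0) = integral UNIV (f' t0)"
    by (metis integral_restrict_UNIV)
  also have "\<dots> = (\<integral>x. f' t0 x \<partial>lborel)"
    by (rule integral_lborel) (rule integrable_continuous_bounded_support[OF c supp])
  finally show ?thesis using D by (simp add: f'_def)
qed

text \<open>The factor \<open>norm y\<close> gives continuity at the origin, where
  \<open>sgn\<close> has no limit; \<open>tent\<close> gives bounded support.\<close>

definition radial_profile :: "('a::real_normed_vector \<Rightarrow> real) \<Rightarrow> 'a \<Rightarrow> real" where
  "radial_profile g y = g (sgn y) * (norm y * tent (norm y))"

lemma continuous_radial_profile:
  fixes g :: "'a::euclidean_space \<Rightarrow> real"
  assumes g: "continuous_on (sphere 0 1) g"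
  shows "continuous_on UNIV (radial_profile g)"
proof -
  obtain B where "\<forall>y\<in>g ` sphere 0 1. norm y \<le> B"
    using compact_imp_bounded[OF compact_continuous_image[OF g compact_sphere]]
    unfolding bounded_iff by blast
  then have B: "\<bar>g x\<bar> \<le> B" if "x \<in> sphere 0 1" for x using that by simp
  have "continuous_on (-{0}) (\<lambda>y::'a. y /\<^sub>R norm y)"
    by (intro continuous_intros) auto
  then have "continuous_on (-{0}) (\<lambda>y. g (y /\<^sub>R norm y))"
    by (rule continuous_on_compose2[OF g]) (auto, metis left_inverse norm_eq_zero)
  then have "continuous_on (-{0}) (radial_profile g)"
    unfolding radial_profile_def sgn_div_norm by (intro continuous_intros)
  then have 1: "isCont (radial_profile g) y" if "y \<noteq> 0" for y
    using that by (simp add: continuous_on_eq_continuous_at open_Compl)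
  have "((\<lambda>y::'a. \<bar>B\<bar> * norm y) \<longlongrightarrow> \<bar>B\<bar> * norm (0::'a)) (at 0)"
    by (intro tendsto_intros)
  then have lim: "((\<lambda>y::'a. \<bar>B\<bar> * norm y) \<longlongrightarrow> 0) (at 0)" by simp
  have "\<bar>radial_profile g y\<bar> \<le> \<bar>B\<bar> * norm y" if "y \<noteq> 0" for y
  proof -
    have "\<bar>g (sgn y)\<bar> \<le> \<bar>B\<bar>" using B[of "sgn y"] that by (simp add: norm_sgn)
    moreover have "norm y * tent (norm y) \<le> norm y"
      by (rule mult_left_le) (auto simp: tent_def)
    ultimately show ?thesis
      unfolding radial_profile_def abs_mult[of "g (sgn y)"]
      by (intro mult_mono) auto
  qed
  then have "eventually (\<lambda>y. norm (radial_profile g y) \<le> \<bar>B\<bar> * norm y) (at 0)"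
    by (auto simp: eventually_at_filter)
  then have "(radial_profile g \<longlongrightarrow> 0) (at 0)"
    using lim by (rule Lim_null_comparison)
  then have "isCont (radial_profile g) 0"
    by (simp add: isCont_def radial_profile_def)
  with 1 show ?thesis
    by (metis continuous_at_imp_continuous_on)
qed

text \<open>For a unit vector \<open>u\<close> this is half the Hessian of the cosine transform,
  where that is twice differentiable.\<close>

definition equator_form :: "(real ^ 'n \<Rightarrow> real) \<Rightarrow> real ^ 'n \<Rightarrow> real ^ 'n \<Rightarrow> real ^ 'n \<Rightarrow> real" where
  "equator_form g u a b = (LINT x:equator u|hausdorff_measure (CARD('n) - 2). (x \<bullet> a) * (x \<bullet> b) * g x)"

lemma continuous_on_equator:
  "continuous_on (sphere 0 1) g \<Longrightarrow> continuous_on (equator u) g"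
  by (rule continuous_on_subset) (auto simp: equator_def)

text \<open>The derivative is an integral over slices along \<open>e\<close>; it is rewritten with
  orthogonal slices and then compared with the Hausdorff integral.\<close>

lemma potential_derivative_equator_form:
  fixes g :: "real ^ 'n \<Rightarrow> real" and \<gamma> \<gamma>' :: "real \<Rightarrow> real ^ 'n"
  assumes card: "CARD('n) \<ge> 3" and g: "continuous_on (sphere 0 1) g" and e: "e \<bullet> e = 1"
    and \<gamma>: "\<And>t. (\<gamma> has_vector_derivative \<gamma>' t) (at t)" and \<gamma>': "continuous_on UNIV \<gamma>'"
    and e\<gamma>: "\<And>t. e \<bullet> \<gamma> t = 1"
  obtains D where
    "((\<lambda>t. half_space_potential e (\<lambda>y. (y \<bullet> v) * radial_profile g y) (\<gamma> t)) has_real_derivative D) (at t)"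
    "measure (equator_image_measure (\<gamma> t)) (equator (\<gamma> t)) * equator_form g (\<gamma> t) (\<gamma>' t) v
      = measure (equator_measure (\<gamma> t)) (equator (\<gamma> t)) * D"
proof -
  let ?\<psi> = "\<lambda>y. (y \<bullet> v) * radial_profile g y"
  define u u' where "u = \<gamma> t" and "u' = \<gamma>' t"
  have u: "u \<noteq> 0" "e \<bullet> u = 1" using e\<gamma>[of t] by (auto simp: u_def)
  have "((\<lambda>t. e \<bullet> \<gamma> t) has_vector_derivative e \<bullet> u') (at t)"
    unfolding u'_def by (rule bounded_linear.has_vector_derivative[OF bounded_linear_inner_right \<gamma>])
  then have "((\<lambda>t::real. 1::real) has_real_derivative e \<bullet> u') (at t)"
    by (simp add: has_real_derivative_iff_has_vector_derivative e\<gamma>)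
  then have eu': "e \<bullet> u' = 0" using DERIV_const DERIV_unique by blast
  have \<psi>: "continuous_on UNIV ?\<psi>"
    by (intro continuous_intros continuous_radial_profile[OF g])
  have \<psi>0: "?\<psi> y = 0" if "norm y > 1" for y
    using that by (simp add: radial_profile_def tent_eq_0)
  define D where "D = (\<integral>x. tent (x \<bullet> e) * (x \<bullet> u' * ?\<psi> (x - (x \<bullet> u) *\<^sub>R e)) \<partial>lborel)"
  have D: "((\<lambda>t. half_space_potential e ?\<psi> (\<gamma> t)) has_real_derivative D) (at t)"
    unfolding D_def u_def u'_def using \<psi> \<psi>0 e \<gamma> \<gamma>' by (rule half_space_potential_derivative)
  have "D = (\<integral>x. tent (x \<bullet> e) * (\<lambda>y. y \<bullet> u' * ?\<psi> y) (x - (x \<bullet> u) *\<^sub>R e) \<partial>lborel)"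
    unfolding D_def by (simp add: inner_diff_left eu')
  also have "\<dots> = (\<integral>x. tent (x \<bullet> u) * (\<lambda>y. y \<bullet> u' * ?\<psi> y) (orth_part u x) \<partial>lborel)"
    by (intro integral_oblique_projection e u borel_measurable_continuous_onI continuous_intros \<psi>)
  also have "\<dots> = (\<integral>z. slab_weight u z * ((sgn (orth_part u z) \<bullet> u') * (sgn (orth_part u z) \<bullet> v) * g (sgn (orth_part u z))) \<partial>lborel)"
  proof (rule Bochner_Integration.integral_cong)
    fix x
    have "orth_part u x \<bullet> a = norm (orth_part u x) * (sgn (orth_part u x) \<bullet> a)" for a
      by (cases "orth_part u x = 0") (auto simp: sgn_div_norm)
    from this[of u'] this[of v]
    show "tent (x \<bullet> u) * (\<lambda>y. y \<bullet> u' * ?\<psi> y) (orth_part u x)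
      = slab_weight u x * ((sgn (orth_part u x) \<bullet> u') * (sgn (orth_part u x) \<bullet> v) * g (sgn (orth_part u x)))"
      by (simp add: slab_weight_def radial_profile_def power3_eq_cube)
  qed simp
  finally have D2: "D = (\<integral>z. slab_weight u z * ((sgn (orth_part u z) \<bullet> u') * (sgn (orth_part u z) \<bullet> v) * g (sgn (orth_part u z))) \<partial>lborel)" .
  have "measure (equator_image_measure u) (equator u) * equator_form g u u' v
      = measure (equator_measure u) (equator u) * D"
    unfolding D2 equator_form_def
    by (intro equator_integral_proportional u card continuous_intros continuous_on_equator[OF g])
  with D show ?thesis unfolding u_def u'_def by (rule that)
qed

lemma set_integrable_equator:
  fixes f :: "real ^ 'n \<Rightarrow> real"
  assumes u: "u \<noteq> 0" and card: "CARD('n) \<ge> 3" and f: "continuous_on (equator u) f"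
  shows "set_integrable (hausdorff_measure (CARD('n) - 2)) (equator u) f"
proof -
  note [measurable_cong] = sets_hausdorff_measure[where 'a = "real ^ 'n"]
  obtain B where B: "\<And>x. x \<in> equator u \<Longrightarrow> \<bar>f x\<bar> \<le> B"
    using compact_imp_bounded[OF compact_continuous_image[OF f compact_equator]] by (auto simp: bounded_iff)
  have "(\<lambda>x. indicator (equator u) x *\<^sub>R f x) \<in> borel_measurable borel"
    using borel_measurable_continuous_on_indicator[OF borel_equator f] .
  then show ?thesis
    unfolding set_integrable_def
    by (intro integrableI_bounded_set[where A = "equator u" and B = B])
       (use B hausdorff_outer_equator_finite[OF u card] in \<open>auto simp: sets_hausdorff_measure
         emeasure_hausdorff_measure measurable_cong_sets[OF sets_hausdorff_measure refl]\<close>)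
qed

section \<open>Isotropy\<close>

lemma equator_form_commute: "equator_form g u a b = equator_form g u b a"
  by (simp add: equator_form_def ac_simps)

lemma equator_form_scale: "equator_form g u (c *\<^sub>R a) b = c * equator_form g u a b"
  by (simp add: equator_form_def mult.assoc)

lemma equator_form_add:
  fixes u :: "real ^ 'n"
  assumes "u \<noteq> 0" "CARD('n) \<ge> 3" "continuous_on (sphere 0 1) g"
  shows "equator_form g u (a + b) c = equator_form g u a c + equator_form g u b c"
proof -
  have "set_integrable (hausdorff_measure (CARD('n) - 2)) (equator u) (\<lambda>x. (x \<bullet> d) * (x \<bullet> c) * g x)" for d
    using assms by (intro set_integrable_equator continuous_intros continuous_on_equator) auto
  from set_integral_add(2)[OF this[of a] this[of b]] show ?thesis
    by (simp add: equator_form_def inner_add_right algebra_simps)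
qed

lemma equator_form_orth_part: "equator_form g u a b = equator_form g u (orth_part u a) b"
proof -
  have "x \<bullet> orth_part u a = x \<bullet> a" if "x \<in> equator u" for x
    using that by (simp add: equator_def orth_part_def inner_diff_right)
  then show ?thesis
    unfolding equator_form_def set_lebesgue_integral_def
    by (intro Bochner_Integration.integral_cong) (auto simp: indicator_def)
qed

lemma inner_orth_part_orth_part:
  "u \<noteq> 0 \<Longrightarrow> orth_part u a \<bullet> orth_part u b = a \<bullet> b - (a \<bullet> u) * (b \<bullet> u) / (u \<bullet> u)"
  by (simp add: orth_part_def inner_diff_left inner_diff_right inner_commute[of u b] field_simps)

text \<open>Homogeneity passes from unit vectors to the hyperplane, polarisation from the quadratic
  to the bilinear form, and the components along \<open>u\<close> do not enter the form.\<close>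

lemma isotropic_equator_form:
  fixes u :: "real ^ 'n"
  assumes u: "u \<noteq> 0" and card: "CARD('n) \<ge> 3" and g: "continuous_on (sphere 0 1) g"
    and iso: "isotropic_on_equator g u"
  obtains \<mu> where "\<And>a b. equator_form g u a b = \<mu> * (orth_part u a \<bullet> orth_part u b)"
proof -
  obtain \<mu> where "\<And>v. v \<in> equator u \<Longrightarrow>
      (LINT x:equator u|hausdorff_measure (CARD('n) - 2). (x \<bullet> v)\<^sup>2 * g x) = \<mu>"
    using iso unfolding isotropic_on_equator_def constant_on_def by blast
  then have \<mu>: "equator_form g u v v = \<mu>" if "v \<in> equator u" for v
    using that by (simp add: equator_form_def power2_eq_square)
  have sq: "equator_form g u a a = \<mu> * (a \<bullet> a)" if a: "a \<bullet> u = 0" for a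
  proof (cases "a = 0")
    case True
    then show ?thesis using equator_form_scale[of g u 0 0 0] by simp
  next
    case False
    then have s: "sgn a \<in> equator u" using a by (simp add: equator_def norm_sgn) (simp add: sgn_div_norm)
    have "a = norm a *\<^sub>R sgn a" using False by (simp add: sgn_div_norm)
    then have "equator_form g u a a = equator_form g u (norm a *\<^sub>R sgn a) (norm a *\<^sub>R sgn a)" by simp
    also have "\<dots> = (norm a)\<^sup>2 * equator_form g u (sgn a) (sgn a)"
      by (simp add: equator_form_scale equator_form_commute[of g u _ "norm a *\<^sub>R sgn a"] power2_eq_square)
    finally show ?thesis by (simp add: \<mu>[OF s] dot_square_norm)
  qed
  note add = equator_form_add[OF u card g]
  have orth: "equator_form g u a b = \<mu> * (a \<bullet> b)" if ab: "a \<bullet> u = 0" "b \<bullet> u = 0" for a b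
  proof -
    have "equator_form g u (a + b) (a + b)
        = equator_form g u a a + equator_form g u b b + 2 * equator_form g u a b"
      using add[of a b "a + b"] add[of a b a] add[of a b b]
      unfolding equator_form_commute[of g u a "a + b"] equator_form_commute[of g u b "a + b"]
        equator_form_commute[of g u b a] by simp
    moreover have "equator_form g u (a + b) (a + b) = \<mu> * ((a + b) \<bullet> (a + b))"
      by (rule sq) (simp add: inner_add_left ab)
    ultimately show ?thesis
      by (simp add: sq ab inner_add_left inner_add_right inner_commute[of b a] algebra_simps)
  qed
  show ?thesis
  proof (rule that)
    fix a b
    have "equator_form g u a b = equator_form g u (orth_part u a) (orth_part u b)"
      by (metis equator_form_orth_part equator_form_commute)
    also have "\<dots> = \<mu> * (orth_part u a \<bullet> orth_part u b)"
      by (intro orth inner_orth_part)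
    finally show "equator_form g u a b = \<mu> * (orth_part u a \<bullet> orth_part u b)" .
  qed
qed

text \<open>Both sides are the trace of the form: \<open>x \<bullet> x = 1\<close> on the equator,
  and a projection onto a hyperplane has trace \<open>CARD('n) - 1\<close>.\<close>

lemma funk_transform_eq_trace:
  fixes u :: "real ^ 'n"
  assumes u: "u \<noteq> 0" and card: "CARD('n) \<ge> 3" and g: "continuous_on (sphere 0 1) g"
    and \<mu>: "\<And>a b. equator_form g u a b = \<mu> * (orth_part u a \<bullet> orth_part u b)"
  shows "funk_transform g u = (real CARD('n) - 1) * \<mu>"
proof -
  have int: "set_integrable (hausdorff_measure (CARD('n) - 2)) (equator u) (\<lambda>x. (x \<bullet> axis i 1) * (x \<bullet> axis i 1) * g x)" for i
    using assms by (intro set_integrable_equator continuous_intros continuous_on_equator) auto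
  have "(\<Sum>i\<in>UNIV. equator_form g u (axis i 1) (axis i 1))
     = (LINT x:equator u|hausdorff_measure (CARD('n) - 2). (\<Sum>i\<in>UNIV. (x \<bullet> axis i 1) * (x \<bullet> axis i 1) * g x))"
    using int unfolding equator_form_def set_lebesgue_integral_def set_integrable_def scaleR_sum_right
    by (intro Bochner_Integration.integral_sum[symmetric])
  also have "\<dots> = funk_transform g u"
    unfolding funk_transform_def set_lebesgue_integral_def
  proof (rule Bochner_Integration.integral_cong)
    fix x
    have "(\<Sum>i\<in>UNIV. (x \<bullet> axis i 1) * (x \<bullet> axis i 1) * g x) = (x \<bullet> x) * g x"
      unfolding sum_distrib_right[symmetric] by (simp add: inner_axis) (simp add: inner_vec_def)
    moreover have "x \<bullet> x = 1" if "x \<in> equator u" using that by (simp add: equator_def dot_square_norm)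
    ultimately show "indicator (equator u) x *\<^sub>R (\<Sum>i\<in>UNIV. (x \<bullet> axis i 1) * (x \<bullet> axis i 1) * g x)
      = indicator (equator u) x *\<^sub>R g x" by (simp add: indicator_def)
  qed simp
  finally have "funk_transform g u = (\<Sum>i\<in>UNIV. \<mu> * (1 - u $ i * u $ i / (u \<bullet> u)))"
    using u by (simp add: \<mu> inner_orth_part_orth_part inner_axis inner_axis')
  also have "\<dots> = \<mu> * (real CARD('n) - (\<Sum>i\<in>UNIV. u $ i * u $ i) / (u \<bullet> u))"
    by (simp add: sum_distrib_left[symmetric] sum_subtractf sum_divide_distrib)
  also have "(\<Sum>i\<in>UNIV. u $ i * u $ i) = u \<bullet> u" by (simp add: inner_vec_def)
  finally show ?thesis using u by simp
qed

section \<open>Comparing two nearby points on a great circle\<close>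

lemma equator_measure_mass_cong:
  fixes a b :: "real ^ 'n"
  assumes "a \<noteq> 0" "b \<noteq> 0"
  shows "measure (equator_measure a) (equator a) = measure (equator_measure b) (equator b)"
proof -
  have *: "measure (equator_measure x) (equator x) = measure (equator_measure (sgn x)) (equator (sgn x))"
    if "x \<noteq> 0" for x :: "real ^ 'n"
    using that equator_scale[of "inverse (norm x)" x] by (simp add: equator_measure_def sgn_div_norm)
  show ?thesis
    using equator_mass_cong(1)[of "sgn a" "sgn b"] assms by (simp add: *[of a] *[of b] norm_sgn)
qed

lemma isotropic_on_equator_scale: "c \<noteq> 0 \<Longrightarrow> isotropic_on_equator g (c *\<^sub>R u) = isotropic_on_equator g u"
  by (simp add: isotropic_on_equator_def equator_scale)

text \<open>Let \<open>F\<close> be the potential along \<open>v\<close>. Along the small circles \<open>\<gamma> s\<close> at height \<open>s\<close>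
  above the great circle through \<open>p\<close> and \<open>q\<close>, isotropy makes \<open>F\<close> constant. Comparing
  the derivatives in \<open>s\<close> at both ends yields equality of the isotropy constants.\<close>

lemma funk_transform_eq_nearby:
  fixes g :: "real ^ 'n \<Rightarrow> real" and H :: "(real ^ 'n) set" and p q :: "real ^ 'n"
  assumes card: "CARD('n) \<ge> 3" and g: "continuous_on (sphere 0 1) g"
    and H: "subspace H" "dim H \<ge> 3"
    and p: "p \<in> H" "norm p = 1" and q: "q \<in> H" "norm q = 1"
    and \<kappa>: "0 < \<kappa>" "\<kappa> < 1" "\<kappa> < q \<bullet> p"
    and iso: "\<And>x. x \<in> H \<Longrightarrow> norm x = 1 \<Longrightarrow> \<kappa> < x \<bullet> p \<Longrightarrow> isotropic_on_equator g x"
  shows "funk_transform g p = funk_transform g q"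
proof -
  define mI mE where "mI = (\<lambda>u::real ^ 'n. measure (equator_image_measure u) (equator u))"
    and "mE = measure (equator_measure p) (equator p)"
  have mE: "measure (equator_measure u) (equator u) = mE" if "u \<noteq> 0" for u :: "real ^ 'n"
    unfolding mE_def using that p by (intro equator_measure_mass_cong) auto
  have mI: "mI u > 0" if "u \<noteq> 0" for u
    unfolding mI_def using that card by (intro equator_image_mass_pos) auto
  have p0: "p \<noteq> 0" and q0: "q \<noteq> 0" using p q by auto
  have pp: "p \<bullet> p = 1" and qq: "q \<bullet> q = 1" using p q by (simp_all add: dot_square_norm)
  obtain \<mu>p where \<mu>p: "\<And>a b. equator_form g p a b = \<mu>p * (orth_part p a \<bullet> orth_part p b)"
    using isotropic_equator_form[OF p0 card g iso[OF p]] \<kappa> pp by auto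
  obtain \<mu>q where \<mu>q: "\<And>a b. equator_form g q a b = \<mu>q * (orth_part q a \<bullet> orth_part q b)"
    using isotropic_equator_form[OF q0 card g iso[OF q]] \<kappa> by auto
  note funk = funk_transform_eq_trace[OF p0 card g \<mu>p] funk_transform_eq_trace[OF q0 card g \<mu>q]
  show ?thesis
  proof (cases "mE = 0")
    \<comment> \<open>If equators had mass zero, proportionality and the positivity of
      \<open>mI\<close> would make every Funk value zero.\<close>
    case True
    have "funk_transform g u = 0" if "u \<noteq> 0" for u
      using equator_integral_proportional[OF that card continuous_on_equator[OF g]] mI[OF that] mE[OF that] True
      by (simp add: funk_transform_def mI_def)
    then show ?thesis using p0 q0 by simp
  next
    case False
    \<comment> \<open>For the angle \<theta> between \<open>p\<close> and \<open>q\<close>: \<alpha>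
      is cos(\<theta>/2), \<open>e\<close> the unit bisector, \<open>W\<close> is tan^2(\<theta>/2),
      and \<open>m t\<close> is the norm of \<open>e + t w\<close>. The points \<open>e - w\<close>
      and \<open>e + w\<close> are \<open>p\<close> and \<open>q\<close> divided by
      \<alpha>.\<close>
    define c \<alpha> e w W m m' where "c = q \<bullet> p" and "\<alpha> = norm (p + q) / 2"
      and "e = (1 / (2 * \<alpha>)) *\<^sub>R (p + q)" and "w = (1 / (2 * \<alpha>)) *\<^sub>R (q - p)" and "W = w \<bullet> w"
      and "m = (\<lambda>t. sqrt (1 + t\<^sup>2 * W))" and "m' = (\<lambda>t. t * W / m t)"
    have c: "0 < c" "p \<bullet> q = c" "q \<bullet> p = c" using \<kappa> by (auto simp: c_def inner_commute)
    have "(norm (p + q))\<^sup>2 = 2 + 2 * c"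
      unfolding dot_square_norm[symmetric] by (simp add: inner_add_left inner_add_right pp qq c)
    then have \<alpha>2: "\<alpha>\<^sup>2 = (1 + c) / 2" by (simp add: \<alpha>_def power_divide)
    have \<alpha>: "\<alpha> > 0"
      using c \<alpha>2 by (metis \<alpha>_def add_pos_pos half_gt_zero less_irrefl norm_ge_zero order_le_less zero_less_one zero_power2 divide_nonneg_pos zero_less_numeral)
    have ee: "e \<bullet> e = 1"
    proof -
      have "(p + q) \<bullet> (p + q) = 4 * \<alpha>\<^sup>2" by (simp add: dot_square_norm \<alpha>_def power_divide)
      then show ?thesis using \<alpha> by (simp add: e_def power2_eq_square)
    qed
    have ew: "e \<bullet> w = 0"
      by (simp add: e_def w_def inner_add_left inner_diff_right pp qq c)
    have W: "W = (1 - c) / (1 + c)"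
    proof -
      have "(q - p) \<bullet> (q - p) = 2 * (1 - c)"
        by (simp add: inner_diff_left inner_diff_right pp qq c)
      then have "W = 2 * (1 - c) / (4 * \<alpha>\<^sup>2)" by (simp add: W_def w_def power2_eq_square)
      also have "\<dots> = (1 - c) / (1 + c)" using c by (simp add: \<alpha>2 divide_simps) (simp add: algebra_simps)
      finally show ?thesis .
    qed
    have W0: "0 \<le> W" by (simp add: W_def)
    have "q \<bullet> p \<le> norm q * norm p" by (rule norm_cauchy_schwarz)
    then have c1: "c \<le> 1" using p q by (simp add: c_def)
    have e_minus: "e - w = (1 / \<alpha>) *\<^sub>R p" and e_plus: "e + w = (1 / \<alpha>) *\<^sub>R q"
    proof -
      have "(p + q) - (q - p) = 2 *\<^sub>R p" "(p + q) + (q - p) = 2 *\<^sub>R q" by (simp_all add: scaleR_2)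
      then show "e - w = (1 / \<alpha>) *\<^sub>R p" "e + w = (1 / \<alpha>) *\<^sub>R q"
        unfolding e_def w_def scaleR_diff_right[symmetric] scaleR_add_right[symmetric] by simp_all
    qed
    have mpos: "m t > 0" "(m t)\<^sup>2 = 1 + t\<^sup>2 * W" for t
      using W0 by (auto simp: m_def intro: add_pos_nonneg)
    have m_deriv: "(m has_real_derivative m' t) (at t)" for t
    proof -
      have pos: "0 < 1 + t\<^sup>2 * W" using W0 by (auto intro: add_pos_nonneg)
      show ?thesis
        unfolding m_def m'_def using pos
        by (auto intro!: derivative_eq_intros simp: field_simps)
    qed
    have m1: "m 1 = m (-1)" by (simp add: m_def)
    \<comment> \<open>Here \<open>dim H \<ge> 3\<close> supplies the axis \<open>v\<close>, a unit
      vector of \<open>H\<close> orthogonal to \<open>p\<close> and \<open>q\<close>.\<close>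
    have "dim {p, q} < dim H"
      using dim_le_card'[of "{p, q}"] card_insert_le_m1[of 2 "{q}" p] H by simp
    have "span {p, q} \<subset> span H"
    proof -
      have "span {p, q} \<subseteq> span H" using p q by (intro span_mono) auto
      moreover have "span {p, q} \<noteq> span H" using \<open>dim {p, q} < dim H\<close> by (metis dim_span less_irrefl)
      ultimately show ?thesis by blast
    qed
    then obtain v0 where v0: "v0 \<noteq> 0" "v0 \<in> span H" "\<And>y. y \<in> span {p, q} \<Longrightarrow> orthogonal v0 y"
      using orthogonal_to_subspace_exists_gen by metis
    define v where "v = sgn v0"
    have vH: "v \<in> H" using v0 H by (simp add: v_def sgn_div_norm span_eq_iff[THEN iffD2] subspace_scale)
    have vv: "v \<bullet> v = 1" using v0 by (simp add: v_def dot_square_norm norm_sgn)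
    have "v0 \<bullet> p = 0" "v0 \<bullet> q = 0" using v0(3) by (auto simp: orthogonal_def span_base)
    then have vpq: "v \<bullet> p = 0" "v \<bullet> q = 0" by (simp_all add: v_def sgn_div_norm)
    then have ve: "v \<bullet> e = 0" "e \<bullet> v = 0" "v \<bullet> w = 0" "w \<bullet> v = 0" "p \<bullet> v = 0" "q \<bullet> v = 0"
      by (simp_all add: e_def w_def inner_add_right inner_diff_right inner_commute)
    \<comment> \<open>The factor \<open>m t\<close> keeps the height over the great circle equal to
      s / sqrt (1 + s^2) after normalisation, while the curve stays in the affine hyperplane
      \<open>e \<bullet> x = 1\<close>.\<close>
    define \<gamma> where "\<gamma> = (\<lambda>s t. e + t *\<^sub>R w + (s * m t) *\<^sub>R v)"
    define F where "F = half_space_potential e (\<lambda>y. (y \<bullet> v) * radial_profile g y)"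
    have e\<gamma>: "e \<bullet> \<gamma> s t = 1" for s t
      by (simp add: \<gamma>_def inner_add_right ee ew ve)
    have \<gamma>0: "\<gamma> s t \<noteq> 0" for s t using e\<gamma>[of s t] by auto
    have \<gamma>v: "v \<bullet> \<gamma> s t = s * m t" for s t
      by (simp add: \<gamma>_def inner_add_right vv ve)
    have \<gamma>w: "w \<bullet> \<gamma> s t = t * W" for s t
      using ew by (simp add: \<gamma>_def inner_add_right ve W_def inner_commute[of w e])
    have \<gamma>\<gamma>: "\<gamma> s t \<bullet> \<gamma> s t = (m t)\<^sup>2 * (1 + s\<^sup>2)" for s t
    proof -
      have "\<gamma> s t \<bullet> \<gamma> s t = e \<bullet> \<gamma> s t + t * (w \<bullet> \<gamma> s t) + s * m t * (v \<bullet> \<gamma> s t)"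
        by (subst \<gamma>_def) (simp add: inner_add_left)
      also have "\<dots> = 1 + t\<^sup>2 * W + s\<^sup>2 * (m t)\<^sup>2"
        by (simp add: e\<gamma> \<gamma>w \<gamma>v power2_eq_square)
      finally show ?thesis by (simp add: mpos algebra_simps)
    qed
    have \<gamma>t: "(\<gamma> s has_vector_derivative w + (s * m' t) *\<^sub>R v) (at t)" for s t
    proof -
      have "((\<lambda>t. s * m t) has_real_derivative s * m' t) (at t)"
        using m_deriv by (rule DERIV_cmult)
      then have "((\<lambda>t. (s * m t) *\<^sub>R v) has_vector_derivative (s * m' t) *\<^sub>R v) (at t)"
        by (intro bounded_linear.has_vector_derivative[OF bounded_linear_scaleR_left])
           (simp add: has_real_derivative_iff_has_vector_derivative)
      moreover have "((\<lambda>t. e + t *\<^sub>R w) has_vector_derivative w) (at t)"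
        by (auto intro!: derivative_eq_intros)
      ultimately show ?thesis unfolding \<gamma>_def by (rule has_vector_derivative_add[rotated])
    qed
    have \<gamma>s: "((\<lambda>s. \<gamma> s t) has_vector_derivative m t *\<^sub>R v) (at s)" for s t
      unfolding \<gamma>_def by (auto intro!: derivative_eq_intros)
    have m_cont: "continuous_on UNIV m"
      unfolding m_def by (intro continuous_intros)
    have m'_cont: "continuous_on UNIV m'"
      unfolding m'_def using mpos(1) m_cont by (intro continuous_intros) (auto simp: less_imp_neq[symmetric])
    \<comment> \<open>Along the arc the inner product with \<open>p\<close> is at least
      \<open>c / \<alpha>\<close> and the norm at most sqrt (1 + s^2) / \<alpha>, so these heights
      keep the arc inside the cap around \<open>p\<close>.\<close>
    define S where "S = {s. \<kappa> * sqrt (1 + s\<^sup>2) < c}"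
    have S: "open S" "0 \<in> S"
      using \<kappa> unfolding S_def by (auto simp: c_def intro!: open_Collect_less continuous_intros)
    have iso_\<gamma>: "isotropic_on_equator g (\<gamma> s t)" if s: "s \<in> S" and t: "-1 \<le> t" "t \<le> 1" for s t
    proof -
      have "e \<in> H" "w \<in> H" using p q H by (auto simp: e_def w_def intro!: subspace_scale subspace_add subspace_diff)
      then have "\<gamma> s t \<in> H" using vH H by (auto simp: \<gamma>_def intro!: subspace_scale subspace_add)
      then have 1: "sgn (\<gamma> s t) \<in> H" using H by (simp add: sgn_div_norm subspace_scale)
      have 2: "norm (sgn (\<gamma> s t)) = 1" using \<gamma>0 by (simp add: norm_sgn)
      have "\<gamma> s t \<bullet> p = ((1 + c) + t * (c - 1)) / (2 * \<alpha>)"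
        using \<alpha> by (simp add: \<gamma>_def inner_add_left e_def w_def inner_diff_left vpq pp c field_simps)
      moreover have "2 * c \<le> (1 + c) + t * (c - 1)"
        using mult_right_mono[OF t(2), of "1 - c"] c1 by (simp add: algebra_simps)
      ultimately have low: "c / \<alpha> \<le> \<gamma> s t \<bullet> p"
        using \<alpha> by (simp add: field_simps)
      have "t\<^sup>2 \<le> 1" using t by (simp add: abs_square_le_1 abs_le_iff)
      then have "1 + t\<^sup>2 * W \<le> 1 + 1 * W" using W0 by (intro add_left_mono mult_right_mono)
      also have "\<dots> = 1 / \<alpha>\<^sup>2" using c by (simp add: W \<alpha>2 field_simps)
      finally have "(m t)\<^sup>2 \<le> (1 / \<alpha>)\<^sup>2" by (simp add: mpos power_divide)
      then have mt: "m t \<le> 1 / \<alpha>" using \<alpha> by (intro power2_le_imp_le[of "m t" "1 / \<alpha>"]) auto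
      have "norm (\<gamma> s t) = sqrt ((m t)\<^sup>2 * (1 + s\<^sup>2))" by (simp add: norm_eq_sqrt_inner \<gamma>\<gamma>)
      also have "\<dots> = m t * sqrt (1 + s\<^sup>2)" using mpos(1)[of t] by (simp add: real_sqrt_mult)
      also have "\<dots> \<le> 1 / \<alpha> * sqrt (1 + s\<^sup>2)" using mt by (intro mult_right_mono) auto
      finally have "\<kappa> * norm (\<gamma> s t) \<le> \<kappa> * (1 / \<alpha> * sqrt (1 + s\<^sup>2))" using \<kappa> by (intro mult_left_mono) auto
      also have "\<dots> = \<kappa> * sqrt (1 + s\<^sup>2) / \<alpha>" by simp
      also have "\<dots> < c / \<alpha>" using s \<alpha> unfolding S_def by (intro divide_strict_right_mono) auto
      finally have "\<kappa> * norm (\<gamma> s t) < \<gamma> s t \<bullet> p" using low by linarith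
      then have 3: "\<kappa> < sgn (\<gamma> s t) \<bullet> p"
        using \<gamma>0[of s t] by (simp add: sgn_div_norm field_simps)
      show ?thesis
        using iso[OF 1 2 3] \<gamma>0[of s t] by (simp add: sgn_div_norm isotropic_on_equator_scale)
    qed
    have F_const: "F (\<gamma> s 1) = F (\<gamma> s (-1))" if s: "s \<in> S" for s
    proof -
      have D0: "((\<lambda>t. F (\<gamma> s t)) has_real_derivative 0) (at t)" if t: "-1 \<le> t" "t \<le> 1" for t
      proof -
        have cont: "continuous_on UNIV (\<lambda>t. w + (s * m' t) *\<^sub>R v)" by (intro continuous_intros m'_cont)
        obtain D where D: "((\<lambda>t. F (\<gamma> s t)) has_real_derivative D) (at t)"
          "mI (\<gamma> s t) * equator_form g (\<gamma> s t) (w + (s * m' t) *\<^sub>R v) v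
            = measure (equator_measure (\<gamma> s t)) (equator (\<gamma> s t)) * D"
          unfolding F_def mI_def
          by (rule potential_derivative_equator_form[OF card g ee \<gamma>t cont e\<gamma>])
        obtain \<mu> where \<mu>: "\<And>a b. equator_form g (\<gamma> s t) a b = \<mu> * (orth_part (\<gamma> s t) a \<bullet> orth_part (\<gamma> s t) b)"
          using isotropic_equator_form[OF \<gamma>0 card g iso_\<gamma>[OF s t]] by blast
        have mm: "m' t * m t = t * W" using mpos(1)[of t] by (simp add: m'_def)
        have "(w + (s * m' t) *\<^sub>R v) \<bullet> \<gamma> s t = t * W + s\<^sup>2 * (m' t * m t)"
          by (simp add: inner_add_left \<gamma>w \<gamma>v power2_eq_square)
        also have "\<dots> = (1 + s\<^sup>2) * (m' t * m t)" by (simp add: mm algebra_simps)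
        finally have i1: "(w + (s * m' t) *\<^sub>R v) \<bullet> \<gamma> s t = (1 + s\<^sup>2) * (m' t * m t)" .
        have i2: "(w + (s * m' t) *\<^sub>R v) \<bullet> v = s * m' t" by (simp add: inner_add_left ve vv)
        have nz: "1 + s\<^sup>2 \<noteq> 0" by (metis add_pos_nonneg less_irrefl zero_le_power2 zero_less_one)
        \<comment> \<open>The normalised height in direction \<open>v\<close> is stationary along
          the circle, so velocity and \<open>v\<close> have orthogonal tangential parts.\<close>
        have "orth_part (\<gamma> s t) (w + (s * m' t) *\<^sub>R v) \<bullet> orth_part (\<gamma> s t) v
            = s * m' t - (1 + s\<^sup>2) * (m' t * m t) * (s * m t) / ((m t)\<^sup>2 * (1 + s\<^sup>2))"
          unfolding inner_orth_part_orth_part[OF \<gamma>0] i1 i2 \<gamma>v \<gamma>\<gamma> ..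
        also have "\<dots> = 0" using mpos(1)[of t] nz by (simp add: power2_eq_square)
        finally have "mE * D = 0" using D(2) \<gamma>0 by (simp add: \<mu> mE)
        then show ?thesis using D(1) False by simp
      qed
      show ?thesis
      proof (rule DERIV_isconst_end[of "-1" 1 "\<lambda>t. F (\<gamma> s t)"])
        show "continuous_on {-1..1} (\<lambda>t. F (\<gamma> s t))"
          by (intro continuous_at_imp_continuous_on ballI DERIV_isCont[OF D0]) auto
      qed (use D0 in auto)
    qed
    \<comment> \<open>At \<open>s = 0\<close> the velocity is \<open>m t\<close> times
      \<open>v\<close>, and \<open>v\<close> is a unit vector orthogonal to \<open>x\<close>, so the
      form returns the isotropy constant.\<close>
    have end_deriv: "\<exists>D. ((\<lambda>s. F (\<gamma> s t)) has_real_derivative D) (at 0) \<and> mI (\<gamma> 0 t) * (m 1 * \<mu>) = mE * D"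
      if t: "m t = m 1" "\<gamma> 0 t = (1 / \<alpha>) *\<^sub>R x" and x: "v \<bullet> x = 0"
        and \<mu>: "\<And>a b. equator_form g x a b = \<mu> * (orth_part x a \<bullet> orth_part x b)" for t x \<mu>
    proof -
      have cont: "continuous_on UNIV (\<lambda>s::real. m t *\<^sub>R v)" by (intro continuous_intros)
      obtain D where D: "((\<lambda>s. F (\<gamma> s t)) has_real_derivative D) (at 0)"
        "mI (\<gamma> 0 t) * equator_form g (\<gamma> 0 t) (m t *\<^sub>R v) v
          = measure (equator_measure (\<gamma> 0 t)) (equator (\<gamma> 0 t)) * D"
        unfolding F_def mI_def
        by (rule potential_derivative_equator_form[OF card g ee \<gamma>s cont e\<gamma>])
      have "equator_form g (\<gamma> 0 t) (m t *\<^sub>R v) v = m t * equator_form g x v v"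
        using \<alpha> by (simp add: equator_form_scale t(2)) (simp add: equator_form_def equator_scale)
      also have "\<dots> = m 1 * \<mu>"
        by (simp add: \<mu> t(1)) (simp add: orth_part_def x vv)
      finally show ?thesis using D \<gamma>0 by (auto simp: mE)
    qed
    have "\<exists>D. ((\<lambda>s. F (\<gamma> s 1)) has_real_derivative D) (at 0) \<and> mI (\<gamma> 0 1) * (m 1 * \<mu>q) = mE * D"
      using vpq e_plus \<mu>q by (intro end_deriv[of 1 q]) (auto simp: \<gamma>_def)
    then obtain D1 where D1: "((\<lambda>s. F (\<gamma> s 1)) has_real_derivative D1) (at 0)" "mI (\<gamma> 0 1) * (m 1 * \<mu>q) = mE * D1"
      by blast
    have "\<exists>D. ((\<lambda>s. F (\<gamma> s (-1))) has_real_derivative D) (at 0) \<and> mI (\<gamma> 0 (-1)) * (m 1 * \<mu>p) = mE * D"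
      using vpq e_minus \<mu>p m1 by (intro end_deriv[of "-1" p]) (auto simp: \<gamma>_def)
    then obtain D2 where D2: "((\<lambda>s. F (\<gamma> s (-1))) has_real_derivative D2) (at 0)" "mI (\<gamma> 0 (-1)) * (m 1 * \<mu>p) = mE * D2"
      by blast
    \<comment> \<open>\<open>F_const\<close> holds for all \<open>s\<close> near 0 and may be
      differentiated there.\<close>
    have "((\<lambda>s. F (\<gamma> s (-1))) has_real_derivative D1) (at 0)"
      using D1(1) S by (rule has_field_derivative_transform_within_open) (simp add: F_const)
    then have DD: "D1 = D2" using D2(1) by (rule DERIV_unique)
    \<comment> \<open>Both ends carry the same scaling, so the norm-dependent factor
      \<open>mI\<close> cancels.\<close>
    have "norm (\<gamma> 0 1) = norm (\<gamma> 0 (-1))" by (simp add: norm_eq_sqrt_inner \<gamma>\<gamma> m1)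
    then have "mI (\<gamma> 0 1) = mI (\<gamma> 0 (-1))" unfolding mI_def by (rule equator_mass_cong)
    then have "mI (\<gamma> 0 1) * m 1 * \<mu>q = mI (\<gamma> 0 1) * m 1 * \<mu>p"
      using D1(2) D2(2) DD by (metis mult.assoc)
    moreover have "mI (\<gamma> 0 1) * m 1 > 0" using mI[OF \<gamma>0] mpos(1) by simp
    ultimately have "\<mu>q = \<mu>p" by auto
    then show ?thesis using funk by simp
  qed
qed

text \<open>Every point of \<open>U\<close> is the centre of a cap of the sphere in \<open>H\<close>
  on which the two-point comparison applies. The Funk transform is thus locally constant, and
  connectedness of a component does the rest.\<close>

theorem theorem4p2:
  fixes g :: "real ^ 'n \<Rightarrow> real" and H U :: "(real ^ 'n) set" and k :: nat
  assumes "CARD('n) \<ge> 4"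
    and "continuous_on (sphere 0 1) g"
    and "C2_on (cosine_transform g) (- {0})"
    and "3 \<le> k" and "k \<le> CARD('n) - 1"
    and "H \<in> grassmannian k"
    and "openin (top_of_set (sphere 0 1 \<inter> H)) U"
    and "\<forall>u\<in>U. isotropic_on_equator g u"
  shows "\<forall>V\<in>components U. funk_transform g constant_on V"
proof
  fix V assume V: "V \<in> components U"
  have H: "subspace H" "dim H \<ge> 3" using assms(4,6) by (auto simp: grassmannian_def)
  have VU: "V \<subseteq> U" using V by (rule in_components_subset)
  have USH: "U \<subseteq> sphere 0 1 \<inter> H" using assms(7) by (rule openin_imp_subset)
  have "eventually (\<lambda>b. funk_transform g a = funk_transform g b) (at a within V)" if a: "a \<in> V" for a
  proof -
    obtain r where r: "r > 0" "ball a r \<inter> (sphere 0 1 \<inter> H) \<subseteq> U"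
      using assms(7) a VU unfolding openin_contains_ball by blast
    have aSH: "a \<in> H" "norm a = 1" using a VU USH by auto
    \<comment> \<open>The value \<open>1 - r\<^sup>2 / 2\<close> is the cosine at chord length
      \<open>r\<close>, so the cap lies in the ball; 1/2 keeps \<kappa> positive.\<close>
    define \<kappa> where "\<kappa> = max (1 / 2) (1 - r\<^sup>2 / 2)"
    have \<kappa>: "0 < \<kappa>" "\<kappa> < 1" using r by (auto simp: \<kappa>_def)
    have dist: "(dist x a)\<^sup>2 = 2 - 2 * (x \<bullet> a)" if "norm x = 1" for x
    proof -
      have "x \<bullet> x = 1" "a \<bullet> a = 1" using that aSH by (simp_all add: dot_square_norm)
      then show ?thesis
        unfolding dist_norm dot_square_norm[symmetric]
        by (simp add: inner_diff_left inner_diff_right inner_commute[of a x])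
    qed
    have iso: "isotropic_on_equator g x" if x: "x \<in> H" "norm x = 1" "\<kappa> < x \<bullet> a" for x
    proof -
      have "(dist x a)\<^sup>2 < r\<^sup>2" using x(3) unfolding dist[OF x(2)] \<kappa>_def by (simp add: field_simps)
      then have "dist x a < r" using r by (simp add: power_less_imp_less_base)
      then have "x \<in> U" using r x by (auto simp: dist_commute)
      then show ?thesis using assms(8) by blast
    qed
    \<comment> \<open>The bound on the distance is the chord length at which the inner product
      equals \<kappa>.\<close>
    have "funk_transform g a = funk_transform g b" if b: "b \<in> V" "dist b a < sqrt (2 * (1 - \<kappa>))" for b
    proof (rule funk_transform_eq_nearby[OF _ assms(2) H aSH _ _ \<kappa> _ iso])
      show "CARD('n) \<ge> 3" using assms(1) by simp
      show bSH: "b \<in> H" "norm b = 1" using b VU USH by auto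
      have "(dist b a)\<^sup>2 < (sqrt (2 * (1 - \<kappa>)))\<^sup>2" using b(2) by (intro power_strict_mono) auto
      then show "\<kappa> < b \<bullet> a" using \<kappa> unfolding dist[OF bSH(2)] by simp
    qed
    then show ?thesis
      unfolding eventually_at using \<kappa> by (intro exI[of _ "sqrt (2 * (1 - \<kappa>))"]) auto
  qed
  then have "funk_transform g a = funk_transform g b" if "a \<in> V" "b \<in> V" for a b
    using connected_local_const[OF in_components_connected[OF V] that] by blast
  then show "funk_transform g constant_on V"
    unfolding constant_on_def by metis
qed

end
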